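(* Let $d,s\in\mathbb{N}$, $1\le p<\infty$, and $r>0$ (with $r>1$ if $p=1$). Let $K:\mathbb{R}^d\to\mathbb{R}$ belong to $\mathcal{K}(s)$ if $p\ge2$, and to $\mathcal{K}_c(s)$ if $1\le p<2$. For $n\in\mathbb{N}$ let $\hat f_n$ be the kernel density estimator associated with $K$ and with bandwidth $h=n^{-1/(2s+d)}$. Let $F^s_p$ be the set of probability density functions in $W^s_p(r)$ if $p\ge2$, and let $F^s_p=W^s_p(r,R)$ for some $R>0$ if $1\le p<2$. Then there exists a constant $c>0$, independent of $n$, such that for every $n\in\mathbb{N}$ $$\sup_{f\in F^s_p}\mathbb{E}_f\|\hat f_n-f\|_p^p\le c\,n^{-sp/(2s+d)}.$$
   Context: $\mathbb{N}$ denotes the positive integers. For a multi-index $\alpha$ of non-negative integers, $|\alpha|$ denotes the sum of its entries, and $x^\alpha$ the corresponding monomial. Norms $\|\cdot\|_p$ are $L^p$ norms with respect to Lebesgue measure. Classical Sobolev space: $f\in L^p(\mathbb{R}^d)$ belongs to $W^s_p=W^s_p(\mathbb{R}^d)$ when $\|f\|_{W^s_p}:=\sum_{|\alpha|\le s}\|\partial^\alpha f\|_p<\infty$ (weak derivatives). $W^s_p(r)$ is the closed ball $\{f:\|f\|_{W^s_p}\le r\}$. $W^s_p(r,R)$ is the set of all probability density functions $f\in W^s_p(r)$ such that $\operatorname{supp} f\subset\{x\in\mathbb{R}^d:|x-x_0|\le R\}$ for some $x_0\in\mathbb{R}^d$. $\mathcal{K}(s)$ is the class of bounded kernels $K:\mathbb{R}^d\to\mathbb{R}$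 with $\int_{\mathbb{R}^d}K(x)\,dx=1$, $\int_{\mathbb{R}^d}x^\alpha K(x)\,dx=0$ for every multi-index $\alpha$ with $1\le|\alpha|<s$, and $\int_{\mathbb{R}^d}|x^\alpha||K(x)|\,dx<\infty$ for every $|\alpha|=s$. $\mathcal{K}_c(s)$ is the subclass of compactly supported kernels in $\mathcal{K}(s)$. Kernel density estimator: given i.i.d. random variables $X_1,\dots,X_n$ in $\mathbb{R}^d$ with density $f$, and a bandwidth $h=h(n)>0$, $$\hat f_n(x)=\frac{1}{nh^d}\sum_{i=1}^nK\Big(\frac{X_i-x}{h}\Big),\quad x\in\mathbb{R}^d.$$ $\mathbb{E}_f$ denotes expectation when the sample is i.i.d. with density $f$. *)

theory Defs
  imports "HOL-Probability.Probability"
begin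

section \<open>Multi-indices\<close>

definition mi_order :: "('d::finite \<Rightarrow> nat) \<Rightarrow> nat" where
  "mi_order \<alpha> = (\<Sum>i\<in>UNIV. \<alpha> i)"

definition mi_monom :: "('d::finite \<Rightarrow> nat) \<Rightarrow> real^'d \<Rightarrow> real" where
  "mi_monom \<alpha> x = (\<Prod>i\<in>UNIV. (x $ i) ^ \<alpha> i)"


section \<open>\<open>L\<^sup>p\<close> spaces with respect to Lebesgue measure\<close>

text \<open>The \<open>p\<close>-th power of the \<open>L\<^sup>p\<close> norm, as an extended real, so that it is meaningful (possibly
  infinite) for every measurable function.\<close>

definition Lp_norm_pow :: "real \<Rightarrow> ('a::euclidean_space \<Rightarrow> real) \<Rightarrow> ennreal" where
  "Lp_norm_pow p f = (\<integral>\<^sup>+ x. ennreal (\<bar>f x\<bar> powr p) \<partial>lborel)"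

definition in_Lp :: "real \<Rightarrow> ('a::euclidean_space \<Rightarrow> real) \<Rightarrow> bool" where
  "in_Lp p f \<longleftrightarrow> f \<in> borel_measurable borel \<and> Lp_norm_pow p f < \<infinity>"

text \<open>Only meaningful when \<open>in_Lp p f\<close> holds.\<close>

definition Lp_norm :: "real \<Rightarrow> ('a::euclidean_space \<Rightarrow> real) \<Rightarrow> real" where
  "Lp_norm p f = enn2real (Lp_norm_pow p f) powr (1 / p)"

definition locally_integrable :: "('a::euclidean_space \<Rightarrow> real) \<Rightarrow> bool" where
  "locally_integrable f \<longleftrightarrow>
     f \<in> borel_measurable borel \<and> (\<forall>C. compact C \<longrightarrow> set_integrable lborel C f)"


section \<open>Weak derivatives and Sobolev balls\<close>

definition partial_deriv :: "'d::finite \<Rightarrow> (real^'d \<Rightarrow> real) \<Rightarrow> real^'d \<Rightarrow> real" where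
  "partial_deriv i \<phi> x = frechet_derivative \<phi> (at x) (axis i 1)"

definition iter_partial :: "'d::finite list \<Rightarrow> (real^'d \<Rightarrow> real) \<Rightarrow> real^'d \<Rightarrow> real" where
  "iter_partial is \<phi> = foldr partial_deriv is \<phi>"

text \<open>If all iterated partial derivatives are totally differentiable everywhere, then they are all
  continuous, so the first conjunct says precisely that \<open>\<phi>\<close> is of class \<open>C\<^sup>\<infinity>\<close>.\<close>

definition test_function :: "(real^'d::finite \<Rightarrow> real) \<Rightarrow> bool" where
  "test_function \<phi> \<longleftrightarrow>
     (\<forall>is x. iter_partial is \<phi> differentiable (at x)) \<and> compact (closure {x. \<phi> x \<noteq> 0})"

text \<open>A list of directions that contains each \<open>i\<close> exactly \<open>\<alpha> i\<close> times realises \<open>\<partial>\<^sup>\<alpha>\<close>. The order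
  of differentiation is immaterial for a test function \<open>\<phi>\<close>, so quantifying over all such lists
  (there is at least one) is the usual integration-by-parts identity for \<open>\<partial>\<^sup>\<alpha> \<phi>\<close>.\<close>

definition has_weak_deriv ::
    "('d::finite \<Rightarrow> nat) \<Rightarrow> (real^'d \<Rightarrow> real) \<Rightarrow> (real^'d \<Rightarrow> real) \<Rightarrow> bool" where
  "has_weak_deriv \<alpha> f g \<longleftrightarrow> locally_integrable f \<and> locally_integrable g \<and>
     (\<forall>\<phi> is. test_function \<phi> \<longrightarrow> (\<forall>i. count_list is i = \<alpha> i) \<longrightarrow>
        (\<integral>x. f x * iter_partial is \<phi> x \<partial>lborel)
          = (- 1) ^ mi_order \<alpha> * (\<integral>x. g x * \<phi> x \<partial>lborel))"

text \<open>Weak derivatives are unique up to null sets; the choice does not affect \<open>L\<^sup>p\<close> membership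
  or norms.\<close>

definition weak_deriv :: "('d::finite \<Rightarrow> nat) \<Rightarrow> (real^'d \<Rightarrow> real) \<Rightarrow> real^'d \<Rightarrow> real" where
  "weak_deriv \<alpha> f = (SOME g. has_weak_deriv \<alpha> f g)"

definition sobolev :: "nat \<Rightarrow> real \<Rightarrow> (real^'d::finite \<Rightarrow> real) set" where
  "sobolev s p = {f. in_Lp p f \<and>
     (\<forall>\<alpha>. mi_order \<alpha> \<le> s \<longrightarrow> (\<exists>g. has_weak_deriv \<alpha> f g) \<and> in_Lp p (weak_deriv \<alpha> f))}"

definition sobolev_norm :: "nat \<Rightarrow> real \<Rightarrow> (real^'d::finite \<Rightarrow> real) \<Rightarrow> real" where
  "sobolev_norm s p f = (\<Sum>\<alpha> | mi_order \<alpha> \<le> s. Lp_norm p (weak_deriv \<alpha> f))"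

text \<open>The sum in \<open>sobolev_norm\<close> ranges over a finite set, so it is never zero by convention.\<close>

lemma finite_mi_order_le: "finite {\<alpha> :: 'd::finite \<Rightarrow> nat. mi_order \<alpha> \<le> s}"
proof (rule finite_subset)
  show "{\<alpha> :: 'd \<Rightarrow> nat. mi_order \<alpha> \<le> s} \<subseteq> PiE UNIV (\<lambda>_. {..s})"
  proof
    fix \<alpha> :: "'d \<Rightarrow> nat"
    assume "\<alpha> \<in> {\<alpha>. mi_order \<alpha> \<le> s}"
    moreover have "\<alpha> i \<le> mi_order \<alpha>" for i
      unfolding mi_order_def by (rule member_le_sum) auto
    ultimately show "\<alpha> \<in> PiE UNIV (\<lambda>_. {..s})"
      by (auto intro: order_trans)
  qed
qed (auto intro: finite_PiE)

definition sobolev_ball :: "nat \<Rightarrow> real \<Rightarrow> real \<Rightarrow> (real^'d::finite \<Rightarrow> real) set" where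
  "sobolev_ball s p r = {f \<in> sobolev s p. sobolev_norm s p f \<le> r}"

definition prob_density :: "('a::euclidean_space \<Rightarrow> real) \<Rightarrow> bool" where
  "prob_density f \<longleftrightarrow> (AE x in lborel. 0 \<le> f x) \<and> has_bochner_integral lborel f 1"

definition sobolev_densities :: "nat \<Rightarrow> real \<Rightarrow> real \<Rightarrow> (real^'d::finite \<Rightarrow> real) set" where
  "sobolev_densities s p r = {f \<in> sobolev_ball s p r. prob_density f}"

text \<open>For an element of \<open>L\<^sup>p\<close> the support is the essential support; it lies in the closed ball
  \<open>cball x0 R\<close> iff the function vanishes almost everywhere outside that ball.\<close>

definition sobolev_densities_supp ::
    "nat \<Rightarrow> real \<Rightarrow> real \<Rightarrow> real \<Rightarrow> (real^'d::finite \<Rightarrow> real) set" where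
  "sobolev_densities_supp s p r R = {f \<in> sobolev_ball s p r. prob_density f \<and>
     (\<exists>x0. AE x in lborel. x \<notin> cball x0 R \<longrightarrow> f x = 0)}"


section \<open>Kernels\<close>

definition kernels :: "nat \<Rightarrow> (real^'d::finite \<Rightarrow> real) set" where
  "kernels s = {K. K \<in> borel_measurable borel \<and> bounded (range K) \<and>
     has_bochner_integral lborel K 1 \<and>
     (\<forall>\<alpha>. 1 \<le> mi_order \<alpha> \<and> mi_order \<alpha> < s \<longrightarrow>
        has_bochner_integral lborel (\<lambda>x. mi_monom \<alpha> x * K x) 0) \<and>
     (\<forall>\<alpha>. mi_order \<alpha> = s \<longrightarrow> integrable lborel (\<lambda>x. \<bar>mi_monom \<alpha> x\<bar> * \<bar>K x\<bar>))}"

definition kernels_compact :: "nat \<Rightarrow> (real^'d::finite \<Rightarrow> real) set" where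
  "kernels_compact s = {K \<in> kernels s. compact (closure {x. K x \<noteq> 0})}"


section \<open>Kernel density estimation from an i.i.d. sample\<close>

definition kde ::
    "(real^'d::finite \<Rightarrow> real) \<Rightarrow> real \<Rightarrow> nat \<Rightarrow> (nat \<Rightarrow> real^'d) \<Rightarrow> real^'d \<Rightarrow> real" where
  "kde K h n X x =
     1 / (real n * h ^ CARD('d)) * (\<Sum>i = 1..n. K ((X i - x) /\<^sub>R h))"

text \<open>Expectation of a nonnegative function of the sample \<open>(X\<^sub>1, \<dots>, X\<^sub>n)\<close> when the \<open>X\<^sub>i\<close> are
  independent with common density \<open>f\<close>, i.e. when the sample has the \<open>n\<close>-fold product law.\<close>

definition sample_measure :: "nat \<Rightarrow> ('a::euclidean_space \<Rightarrow> real) \<Rightarrow> (nat \<Rightarrow> 'a) measure" where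
  "sample_measure n f = PiM {1..n} (\<lambda>_. density lborel (\<lambda>x. ennreal (f x)))"

definition sample_expectation ::
    "nat \<Rightarrow> ('a::euclidean_space \<Rightarrow> real) \<Rightarrow> ((nat \<Rightarrow> 'a) \<Rightarrow> ennreal) \<Rightarrow> ennreal" where
  "sample_expectation n f \<Phi> = (\<integral>\<^sup>+ X. \<Phi> X \<partial>sample_measure n f)"

lemma (in prob_space) sample_expectation_iid:
  fixes X :: "nat \<Rightarrow> 'a \<Rightarrow> 'b::euclidean_space"
  assumes n: "n \<ge> 1"
    and ind: "indep_vars (\<lambda>_. borel) X {1..n}"
    and dist: "\<And>i. i \<in> {1..n} \<Longrightarrow> distributed M lborel (X i) (\<lambda>x. ennreal (f x))"
    and meas: "\<Phi> \<in> borel_measurable (PiM {1..n} (\<lambda>_. borel))"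
  shows "sample_expectation n f \<Phi> = (\<integral>\<^sup>+ \<omega>. \<Phi> (\<lambda>i\<in>{1..n}. X i \<omega>) \<partial>M)"
proof -
  have rv: "\<And>i. i \<in> {1..n} \<Longrightarrow> random_variable borel (X i)"
    using ind by (auto simp: indep_vars_def)
  have d: "distr M borel (X i) = density lborel (\<lambda>x. ennreal (f x))" if "i \<in> {1..n}" for i
  proof -
    have "distr M borel (X i) = distr M lborel (X i)"
      by (rule distr_cong) auto
    then show ?thesis
      using distributed_distr_eq_density[OF dist[OF that]] by simp
  qed
  have "sample_measure n f = PiM {1..n} (\<lambda>i. distr M borel (X i))"
    unfolding sample_measure_def by (rule PiM_cong) (auto simp: d)
  also have "\<dots> = distr M (PiM {1..n} (\<lambda>_. borel)) (\<lambda>\<omega>. \<lambda>i\<in>{1..n}. X i \<omega>)"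
    using indep_vars_iff_distr_eq_PiM'[of "{1..n}" X "\<lambda>_. borel"] rv ind n by auto
  finally have "sample_measure n f =
      distr M (PiM {1..n} (\<lambda>_. borel)) (\<lambda>\<omega>. \<lambda>i\<in>{1..n}. X i \<omega>)" .
  moreover have "(\<lambda>\<omega>. \<lambda>i\<in>{1..n}. X i \<omega>) \<in> measurable M (PiM {1..n} (\<lambda>_. borel))"
    using rv by (intro measurable_restrict) auto
  ultimately show ?thesis
    unfolding sample_expectation_def using meas by (simp add: nn_integral_distr)
qed

end

theory Submission
  imports Defs "HOL-Computational_Algebra.Polynomial"
begin

text \<open>
  The error splits into a stochastic part and the bias. At a fixed point the stochastic part is a
  normalised sum of i.i.d. bounded centred variables, so for \<open>p \<ge> 2\<close> Rosenthal's inequality bounds its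
  \<open>p\<close>-th moment by \<open>(n h^d)^(-p/2) (g^(p/2) + g)\<close> up to a constant, where \<open>g\<close> averages shifts of \<open>f\<close>
  with the weight \<open>K^2\<close>; Young's inequality bounds the integrals of \<open>g\<close> and \<open>g^p\<close>. For \<open>p < 2\<close> second
  moments suffice, since everything lives on a ball of fixed radius.

  The bias is tested against a test function \<open>\<phi>\<close>: Taylor's formula for \<open>\<phi> (x - h u)\<close>, the vanishing
  moments of \<open>K\<close> and the definition of weak derivatives exhibit it as an average of shifts of the
  weak derivatives of order \<open>s\<close> of \<open>f\<close>, with a kernel of total mass of order \<open>h^s\<close>. Young's inequality
  then bounds it, and \<open>h = n^(-1/(2s+d))\<close> balances the two parts.
\<close>

section \<open>Rosenthal's inequality\<close>

text \<open>The threshold p = 2 comes from the term g^(p/2). For p >= 2 the exponent p/2 lies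
  between 1 and p, so g^(p/2) <= g + g^p, and both summands have integrals bounded uniformly in f,
  because f has mass 1 and L^p norm at most r. For p < 2 the integral of g^(p/2) over the whole
  space can diverge when f has heavy tails; compact supports prevent this. For the bias the obstacle
  is that f has only weak derivatives, so it has no pointwise Taylor expansion along segments.
  Expanding the test function instead avoids any approximation of f by smooth functions. The price
  is that the representation has to be recovered from its pairings with test functions, which calls
  for the fundamental lemma of the calculus of variations and for an explicit supply of test
  functions.\<close>

lemma abs_add_powr_le:
  fixes a b p :: real
  assumes "0 \<le> p"
  shows "\<bar>a + b\<bar> powr p \<le> 2 powr p * (\<bar>a\<bar> powr p + \<bar>b\<bar> powr p)"
proof -
  have "\<bar>a + b\<bar> powr p \<le> (2 * max \<bar>a\<bar> \<bar>b\<bar>) powr p"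
    using assms by (intro powr_mono2) auto
  also have "\<dots> = 2 powr p * max \<bar>a\<bar> \<bar>b\<bar> powr p"
    by (simp add: powr_mult)
  also have "max \<bar>a\<bar> \<bar>b\<bar> powr p \<le> \<bar>a\<bar> powr p + \<bar>b\<bar> powr p"
    by (auto simp: max_def)
  finally show ?thesis by simp
qed

text \<open>Compare \<open>t\<close> with a^2: the smaller of the two can be replaced by the larger.
  The point is that |a|^p comes out with coefficient exactly 1, so that a suitably scaled
  \<open>t\<close> turns the mixed term of the Taylor estimate into a factor 1 + 1/n.\<close>

lemma mult_abs_powr_le:
  fixes a p t :: real
  assumes "2 \<le> p" "0 \<le> t"
  shows "t * \<bar>a\<bar> powr (p - 2) \<le> \<bar>a\<bar> powr p + t powr (p / 2)"
proof (cases "a = 0 \<or> t = 0")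
  case False
  have split: "x powr p = x\<^sup>2 * x powr (p - 2)" if "x > 0" for x :: real
    using that by (simp flip: powr_add powr_numeral)
  show ?thesis
  proof (cases "t \<le> \<bar>a\<bar>\<^sup>2")
    case True
    then have "t * \<bar>a\<bar> powr (p - 2) \<le> \<bar>a\<bar>\<^sup>2 * \<bar>a\<bar> powr (p - 2)"
      by (intro mult_right_mono) auto
    then show ?thesis
      using split[of "\<bar>a\<bar>"] False by (simp add: add_increasing2)
  next
    case a: False
    with assms have "\<bar>a\<bar> \<le> sqrt t"
      by (simp add: real_le_rsqrt)
    then have "t * \<bar>a\<bar> powr (p - 2) \<le> (sqrt t)\<^sup>2 * sqrt t powr (p - 2)"
      using assms by (auto intro!: mult_left_mono powr_mono2)
    also have "\<dots> = sqrt t powr p"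
      using split[of "sqrt t"] False assms by auto
    also have "\<dots> = t powr (p / 2)"
      using assms by (simp add: powr_half_sqrt[symmetric] powr_powr)
    finally show ?thesis by (simp add: add_increasing)
  qed
qed auto

text \<open>The first summand bounds the second-order remainder when b is small against a. The other
  two bound the whole power and the linear term when |b| > |a|/2.\<close>

definition powr_taylor_const :: "real \<Rightarrow> real" where
  "powr_taylor_const p = p * (p - 1) * 2 powr (p - 2) + 3 powr p + p * 2 powr (p - 1)"

lemma powr_taylor_const_pos: "2 \<le> p \<Longrightarrow> 0 < powr_taylor_const p"
  unfolding powr_taylor_const_def by (intro add_pos_nonneg add_nonneg_pos) auto

text \<open>The linear term is kept exactly, since it disappears in expectation for a centred
  \<open>b\<close>. If |b| <= a/2, Taylor's formula is applied on [a/2, 3a/2], away from 0, where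
  powers need not be smooth. Otherwise a < 2|b|, and |a + b|^p and the linear term are at most
  multiples of |b|^p.\<close>

lemma add_powr_le_taylor_pos:
  fixes a b p :: real
  assumes p: "2 \<le> p" and a: "0 < a"
  shows "\<bar>a + b\<bar> powr p \<le> a powr p + p * a powr (p - 1) * b
           + powr_taylor_const p * (a powr (p - 2) * b\<^sup>2 + \<bar>b\<bar> powr p)"
proof (cases "\<bar>b\<bar> \<le> a / 2")
  case True
  let ?C1 = "p * (p - 1) * 2 powr (p - 2)"
  have "\<bar>a + b\<bar> powr p \<le> a powr p + p * a powr (p - 1) * b + ?C1 * (a powr (p - 2) * b\<^sup>2)"
  proof (cases "b = 0")
    case False
    define diff :: "nat \<Rightarrow> real \<Rightarrow> real" where
      "diff m t = (if m = 0 then t powr p else if m = 1 then p * t powr (p - 1)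
                   else p * (p - 1) * t powr (p - 2))" for m t
    have "\<exists>t. (if a + b < a then a + b < t \<and> t < a else a < t \<and> t < a + b) \<and>
       (a + b) powr p = (\<Sum>m<2. diff m a / fact m * (a + b - a) ^ m) + diff 2 t / fact 2 * (a + b - a) ^ 2"
    proof (rule Taylor[where a = "a / 2" and b = "3 * a / 2"])
      show "\<forall>m t. m < 2 \<and> a / 2 \<le> t \<and> t \<le> 3 * a / 2 \<longrightarrow> (diff m has_real_derivative diff (Suc m) t) (at t)"
      proof (intro allI impI)
        fix m :: nat and t :: real
        assume *: "m < 2 \<and> a / 2 \<le> t \<and> t \<le> 3 * a / 2"
        with a have t: "t > 0" by linarith
        consider "m = 0" | "m = 1" using * by linarith
        then show "(diff m has_real_derivative diff (Suc m) t) (at t)"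
          unfolding diff_def using t by cases (auto intro!: derivative_eq_intros)
      qed
    qed (use True False a in \<open>auto simp: diff_def fun_eq_iff\<close>)
    then obtain t where t: "if a + b < a then a + b < t \<and> t < a else a < t \<and> t < a + b"
      and eq: "(a + b) powr p = a powr p + p * a powr (p - 1) * b + p * (p - 1) * t powr (p - 2) / 2 * b\<^sup>2"
      by (auto simp: diff_def numeral_2_eq_2)
    have "t powr (p - 2) \<le> (2 * a) powr (p - 2)"
      using t True a p by (intro powr_mono2) (auto split: if_splits)
    also have "\<dots> = 2 powr (p - 2) * a powr (p - 2)"
      using a by (simp add: powr_mult)
    finally have "p * (p - 1) * t powr (p - 2) / 2 * b\<^sup>2
        \<le> p * (p - 1) * (2 powr (p - 2) * a powr (p - 2)) * b\<^sup>2"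
    proof (intro mult_right_mono)
      assume le: "t powr (p - 2) \<le> 2 powr (p - 2) * a powr (p - 2)"
      have "p * (p - 1) * (t powr (p - 2) / 2) \<le> p * (p - 1) * (2 powr (p - 2) * a powr (p - 2))"
      proof (intro mult_left_mono)
        show "t powr (p - 2) / 2 \<le> 2 powr (p - 2) * a powr (p - 2)"
          using le powr_ge_zero[of t "p - 2"] by linarith
      qed (use p in auto)
      then show "p * (p - 1) * t powr (p - 2) / 2 \<le> p * (p - 1) * (2 powr (p - 2) * a powr (p - 2))"
        by simp
    qed auto
    moreover have "\<bar>a + b\<bar> = a + b" using True a by linarith
    ultimately show ?thesis using eq by (simp add: mult_ac)
  qed (use a in auto)
  also have "?C1 * (a powr (p - 2) * b\<^sup>2) \<le> powr_taylor_const p * (a powr (p - 2) * b\<^sup>2 + \<bar>b\<bar> powr p)"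
    unfolding powr_taylor_const_def using p
    by (intro mult_mono) (auto intro!: add_nonneg_nonneg)
  finally show ?thesis by simp
next
  case False
  have "\<bar>a + b\<bar> powr p \<le> (3 * \<bar>b\<bar>) powr p"
    using False p a by (intro powr_mono2) auto
  then have 1: "\<bar>a + b\<bar> powr p \<le> 3 powr p * \<bar>b\<bar> powr p"
    by (simp add: powr_mult)
  have "a powr (p - 1) * \<bar>b\<bar> \<le> (2 * \<bar>b\<bar>) powr (p - 1) * \<bar>b\<bar>"
    using False p a by (intro mult_right_mono powr_mono2) auto
  also have "\<dots> = 2 powr (p - 1) * \<bar>b\<bar> powr p"
    using False a by (simp add: powr_mult powr_diff)
  finally have "p * (a powr (p - 1) * \<bar>b\<bar>) \<le> p * (2 powr (p - 1) * \<bar>b\<bar> powr p)"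
    using p by (intro mult_left_mono) auto
  moreover have "- (p * a powr (p - 1) * b) \<le> p * (a powr (p - 1) * \<bar>b\<bar>)"
  proof -
    have "(p * a powr (p - 1)) * (- b) \<le> (p * a powr (p - 1)) * \<bar>b\<bar>"
      using p by (intro mult_left_mono) auto
    then show ?thesis by (simp add: mult_ac)
  qed
  ultimately have 2: "0 \<le> p * a powr (p - 1) * b + p * 2 powr (p - 1) * \<bar>b\<bar> powr p"
    by simp
  have "(3 powr p + p * 2 powr (p - 1)) * \<bar>b\<bar> powr p
      \<le> powr_taylor_const p * (a powr (p - 2) * b\<^sup>2 + \<bar>b\<bar> powr p)"
    unfolding powr_taylor_const_def using p
    by (intro mult_mono) (auto intro!: add_nonneg_nonneg)
  moreover have "0 \<le> a powr p" by simp
  ultimately show ?thesis using 1 2 by (simp only: distrib_right)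
qed

lemma abs_add_powr_le_taylor:
  fixes a b p :: real
  assumes p: "2 \<le> p"
  shows "\<bar>a + b\<bar> powr p \<le> \<bar>a\<bar> powr p + p * sgn a * \<bar>a\<bar> powr (p - 1) * b
           + powr_taylor_const p * (\<bar>a\<bar> powr (p - 2) * b\<^sup>2 + \<bar>b\<bar> powr p)"
proof -
  consider "a = 0" | "a > 0" | "a < 0" by linarith
  then show ?thesis
  proof cases
    case 1
    \<comment> \<open>Since \<open>0 powr x = 0\<close> also for \<open>x = 0\<close>, at
      \<open>a = 0\<close> the right-hand side is just the constant times |b|^p, even when p =
      2.\<close>
    have "1 \<le> powr_taylor_const p"
    proof -
      have "1 \<le> 3 powr p" using p by (intro ge_one_powr_ge_zero) auto
      moreover have "0 \<le> p * (p - 1) * 2 powr (p - 2)" "0 \<le> p * 2 powr (p - 1)"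
        using p by auto
      ultimately show ?thesis unfolding powr_taylor_const_def by linarith
    qed
    then have "\<bar>b\<bar> powr p \<le> powr_taylor_const p * \<bar>b\<bar> powr p"
      by (simp add: mult_le_cancel_right1)
    then show ?thesis using 1 by simp
  next
    case 2
    then show ?thesis using add_powr_le_taylor_pos[OF p 2, of b] by simp
  next
    case 3
    then have "\<bar>- a + - b\<bar> = \<bar>a + b\<bar>" by linarith
    then show ?thesis using add_powr_le_taylor_pos[OF p, of "- a" "- b"] 3 by simp
  qed
qed

text \<open>The step that adds one term to a partial sum with value \<open>a\<close>. Here
  \<open>n\<close> is the length of the full sum: each step may cost a factor 1 + 1/n, because n
  such factors stay bounded.\<close>

lemma (in prob_space) nn_integral_abs_add_powr_le:
  fixes Z :: "'a \<Rightarrow> real" and p a m :: real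
  assumes p: "2 \<le> p" and n: "1 \<le> n"
    and Z[measurable]: "Z \<in> borel_measurable M"
    and bound: "\<And>y. \<bar>Z y\<bar> \<le> m" and mean: "expectation Z = 0"
  defines "B \<equiv> (powr_taylor_const p * real n * expectation (\<lambda>y. (Z y)\<^sup>2)) powr (p / 2)
      + powr_taylor_const p * real n * expectation (\<lambda>y. \<bar>Z y\<bar> powr p)"
  shows "(\<integral>\<^sup>+ y. ennreal (\<bar>a + Z y\<bar> powr p) \<partial>M)
    \<le> ennreal ((1 + 1 / real n) * \<bar>a\<bar> powr p + B / real n)"
proof -

  let ?C = "powr_taylor_const p"
  have C: "0 < ?C" using powr_taylor_const_pos[OF p] .
  have m: "0 \<le> m" using bound[of undefined] by linarith
  have i0: "integrable M Z"
    by (rule integrable_const_bound[of _ m]) (use bound in auto)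
  have i1: "integrable M (\<lambda>y. \<bar>a + Z y\<bar> powr p)"
  proof (rule integrable_const_bound[of _ "(\<bar>a\<bar> + m) powr p"])
    have "\<bar>a + Z y\<bar> \<le> \<bar>a\<bar> + m" for y
      using bound[of y] abs_triangle_ineq[of a "Z y"] by linarith
    then show "AE x in M. norm (\<bar>a + Z x\<bar> powr p) \<le> (\<bar>a\<bar> + m) powr p"
      using p by (auto intro!: powr_mono2)
  qed simp
  have i2: "integrable M (\<lambda>y. (Z y)\<^sup>2)"
  proof (rule integrable_const_bound[of _ "m\<^sup>2"])
    show "AE x in M. norm ((Z x)\<^sup>2) \<le> m\<^sup>2"
      using bound m by (auto simp: abs_le_square_iff[symmetric])
  qed simp
  have i3: "integrable M (\<lambda>y. \<bar>Z y\<bar> powr p)"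
  proof (rule integrable_const_bound[of _ "m powr p"])
    show "AE x in M. norm (\<bar>Z x\<bar> powr p) \<le> m powr p"
      using bound p by (auto intro!: powr_mono2)
  qed simp
  let ?s = "expectation (\<lambda>y. (Z y)\<^sup>2)" and ?q = "expectation (\<lambda>y. \<bar>Z y\<bar> powr p)"
  have "expectation (\<lambda>y. \<bar>a + Z y\<bar> powr p)
      \<le> expectation (\<lambda>y. \<bar>a\<bar> powr p + p * sgn a * \<bar>a\<bar> powr (p - 1) * Z y
           + ?C * (\<bar>a\<bar> powr (p - 2) * (Z y)\<^sup>2 + \<bar>Z y\<bar> powr p))"
    by (intro integral_mono abs_add_powr_le_taylor[OF p] i1 Bochner_Integration.integrable_add
        integrable_mult_right i0 i2 i3) auto
  also have "\<dots> = \<bar>a\<bar> powr p + ?C * (\<bar>a\<bar> powr (p - 2) * ?s + ?q)"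
    using i0 i2 i3 mean by (simp add: prob_space)
  \<comment> \<open>The remainder is multiplied and divided by n before
    \<open>mult_abs_powr_le\<close> is applied with t = C n E(Z^2); the copy of |a|^p that this
    creates then carries the factor 1/n.\<close>
  also have "\<dots> = \<bar>a\<bar> powr p + ((?C * real n * ?s) * \<bar>a\<bar> powr (p - 2) + ?C * real n * ?q) / real n"
    using n by (simp add: field_simps)
  also have "\<dots> \<le> \<bar>a\<bar> powr p + ((\<bar>a\<bar> powr p + (?C * real n * ?s) powr (p / 2)) + ?C * real n * ?q) / real n"
    using C p by (intro add_left_mono divide_right_mono add_right_mono mult_abs_powr_le) auto
  also have "\<dots> = (1 + 1 / real n) * \<bar>a\<bar> powr p + B / real n"
    using n by (simp add: B_def field_simps)
  finally have "expectation (\<lambda>y. \<bar>a + Z y\<bar> powr p) \<le> (1 + 1 / real n) * \<bar>a\<bar> powr p + B / real n" .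
  then show ?thesis
    by (subst nn_integral_eq_integral[OF i1]) (auto intro: ennreal_leI)
qed

text \<open>For a sum of \<open>n\<close> terms the recursion \<open>a\<^bsub>k+1\<^esub> \<le> (1 + 1/n) a\<^bsub>k\<^esub> + B/n\<close> gives
  \<open>a\<^bsub>k\<^esub> \<le> ((1 + 1/n)^k - 1) B\<close>, and \<open>(1 + 1/n)^n \<le> e < 3\<close>.\<close>

lemma (in prob_space) Rosenthal_inequality:
  fixes Z :: "'a \<Rightarrow> real" and p m :: real
  assumes p: "2 \<le> p" and n: "1 \<le> n"
    and Z[measurable]: "Z \<in> borel_measurable M"
    and bound: "\<And>y. \<bar>Z y\<bar> \<le> m" and mean: "expectation Z = 0"
  shows "(\<integral>\<^sup>+ X. ennreal (\<bar>\<Sum>i=1..n. Z (X i)\<bar> powr p) \<partial>PiM {1..n} (\<lambda>_. M))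
    \<le> ennreal (2 * ((powr_taylor_const p * real n * expectation (\<lambda>y. (Z y)\<^sup>2)) powr (p / 2)
      + powr_taylor_const p * real n * expectation (\<lambda>y. \<bar>Z y\<bar> powr p)))"
    (is "_ \<le> ennreal (2 * ?B)")
proof -
  interpret P: product_sigma_finite "\<lambda>_::nat. M" by standard
  have B: "0 \<le> ?B"
    using powr_taylor_const_pos[OF p] by (intro add_nonneg_nonneg mult_nonneg_nonneg) auto
  define q where "q = 1 + 1 / real n"
  have q: "1 \<le> q" by (simp add: q_def)
  \<comment> \<open>After adding \<open>?B\<close> on both sides the recursion is purely geometric,
    since B/n = (q - 1) B; it starts from the empty sum with value 0.\<close>
  have main: "(\<integral>\<^sup>+ X. ennreal (\<bar>\<Sum>i\<in>I. Z (X i)\<bar> powr p) \<partial>PiM I (\<lambda>_. M)) \<le> ennreal ((q ^ card I - 1) * ?B)"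
    if "finite I" for I :: "nat set"
    using that
  proof (induction I)
    case empty
    show ?case by (simp add: nn_integral_empty)
  next
    case (insert j I)
    interpret I: prob_space "PiM I (\<lambda>_. M)"
      by (intro prob_space_PiM) unfold_locales
    have "(\<integral>\<^sup>+ X. ennreal (\<bar>\<Sum>i\<in>insert j I. Z (X i)\<bar> powr p) \<partial>PiM (insert j I) (\<lambda>_. M))
        = (\<integral>\<^sup>+ X. (\<integral>\<^sup>+ y. ennreal (\<bar>\<Sum>i\<in>insert j I. Z ((X(j := y)) i)\<bar> powr p) \<partial>M) \<partial>PiM I (\<lambda>_. M))"
      by (rule P.product_nn_integral_insert[OF insert(1,2)]) measurable
    also have "\<dots> = (\<integral>\<^sup>+ X. (\<integral>\<^sup>+ y. ennreal (\<bar>(\<Sum>i\<in>I. Z (X i)) + Z y\<bar> powr p) \<partial>M) \<partial>PiM I (\<lambda>_. M))"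
    proof (intro nn_integral_cong)
      fix X :: "nat \<Rightarrow> 'a" and y :: 'a
      have "(\<Sum>i\<in>insert j I. Z ((X(j := y)) i)) = Z y + (\<Sum>i\<in>I. Z ((X(j := y)) i))"
        using insert by simp
      also have "(\<Sum>i\<in>I. Z ((X(j := y)) i)) = (\<Sum>i\<in>I. Z (X i))"
        using insert by (intro sum.cong) auto
      finally show "ennreal (\<bar>\<Sum>i\<in>insert j I. Z ((X(j := y)) i)\<bar> powr p)
          = ennreal (\<bar>(\<Sum>i\<in>I. Z (X i)) + Z y\<bar> powr p)"
        by (simp add: add.commute)
    qed
    also have "\<dots> \<le> (\<integral>\<^sup>+ X. ennreal (q * \<bar>\<Sum>i\<in>I. Z (X i)\<bar> powr p + ?B / real n) \<partial>PiM I (\<lambda>_. M))"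
      unfolding q_def by (intro nn_integral_mono nn_integral_abs_add_powr_le[OF p n Z bound mean])
    also have "\<dots> = (\<integral>\<^sup>+ X. ennreal q * ennreal (\<bar>\<Sum>i\<in>I. Z (X i)\<bar> powr p) + ennreal (?B / real n) \<partial>PiM I (\<lambda>_. M))"
      using q B by (intro nn_integral_cong) (auto simp: ennreal_plus ennreal_mult)
    also have "\<dots> = ennreal q * (\<integral>\<^sup>+ X. ennreal (\<bar>\<Sum>i\<in>I. Z (X i)\<bar> powr p) \<partial>PiM I (\<lambda>_. M)) + ennreal (?B / real n)"
      by (subst nn_integral_add) (auto simp: nn_integral_cmult I.emeasure_space_1)
    also have "\<dots> \<le> ennreal q * ennreal ((q ^ card I - 1) * ?B) + ennreal (?B / real n)"
      by (intro add_right_mono mult_left_mono insert.IH) auto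
    also have "\<dots> = ennreal (q * ((q ^ card I - 1) * ?B) + ?B / real n)"
      using q B by (auto simp: ennreal_plus ennreal_mult)
    also have "q * ((q ^ card I - 1) * ?B) + ?B / real n = (q ^ card (insert j I) - 1) * ?B"
    proof -
      have "1 / real n = q - 1" by (simp add: q_def)
      moreover have "q * ((q ^ card I - 1) * ?B) + ?B / real n = q * ((q ^ card I - 1) * ?B) + (1 / real n) * ?B"
        by simp
      ultimately show ?thesis using insert by (simp only: card_insert_disjoint power_Suc) (simp add: algebra_simps)
    qed
    finally show ?case .
  qed
  have "q ^ n \<le> exp (1 / real n) ^ n"
    unfolding q_def by (intro power_mono) (use exp_ge_add_one_self[of "1 / real n"] in auto)
  also have "\<dots> = exp 1" using n by (simp flip: exp_of_nat_mult)
  also have "\<dots> \<le> 3" by (rule exp_le)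
  finally have "(q ^ n - 1) * ?B \<le> 2 * ?B"
    using B by (intro mult_right_mono) auto
  then show ?thesis
    using main[of "{1..n}"] by (auto intro: order_trans ennreal_leI)
qed

section \<open>Averages of shifts\<close>

lemma nn_integral_lborel_affine:
  fixes t :: "'a::euclidean_space"
  assumes [measurable]: "f \<in> borel_measurable borel" and c: "c \<noteq> 0"
  shows "(\<integral>\<^sup>+ x. f x \<partial>lborel) = ennreal (\<bar>c\<bar> ^ DIM('a)) * (\<integral>\<^sup>+ x. f (t + c *\<^sub>R x) \<partial>lborel)"
  by (subst lborel_affine[OF c, of t])
     (simp add: nn_integral_density nn_integral_distr nn_integral_cmult)

lemma lborel_integral_affine:
  fixes t :: "'a::euclidean_space" and f :: "'a \<Rightarrow> real"
  assumes [measurable]: "f \<in> borel_measurable borel" and c: "c \<noteq> 0"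
  shows "(\<integral>x. f x \<partial>lborel) = \<bar>c\<bar> ^ DIM('a) * (\<integral>x. f (t + c *\<^sub>R x) \<partial>lborel)"
  by (subst lborel_affine[OF c, of t])
     (simp add: integral_density integral_distr)

lemma nn_integral_lborel_translate:
  fixes t :: "'a::euclidean_space"
  assumes "f \<in> borel_measurable borel"
  shows "(\<integral>\<^sup>+ x. f (x + t) \<partial>lborel) = (\<integral>\<^sup>+ x. f x \<partial>lborel)"
  using nn_integral_lborel_affine[of f 1 t] assms by (simp add: add.commute)

lemma lborel_integral_translate:
  fixes t :: "'a::euclidean_space" and f :: "'a \<Rightarrow> real"
  assumes "f \<in> borel_measurable borel"
  shows "(\<integral>x. f (x + t) \<partial>lborel) = (\<integral>x. f x \<partial>lborel)"
  using lborel_integral_affine[of f 1 t] assms by (simp add: add.commute)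

text \<open>The supporting line of a convex function. The convexity used is that on the open
  half-line, so y = 0 is treated apart: there the claim is (1 - p) c^p <= 0.\<close>

lemma powr_ge_tangent:
  fixes p c y :: real
  assumes p: "1 \<le> p" and c: "0 < c" and y: "0 \<le> y"
  shows "c powr p + p * c powr (p - 1) * (y - c) \<le> y powr p"
proof (cases "y = 0")
  case True
  have eq: "c powr (p - 1) * c = c powr p"
    using c by (simp add: powr_diff)
  have "p * c powr (p - 1) * (y - c) = - (p * (c powr (p - 1) * c))"
    using True by simp
  also have "\<dots> = - (p * c powr p)" unfolding eq ..
  finally have "p * c powr (p - 1) * (y - c) = - (p * c powr p)" .
  moreover have "c powr p \<le> p * c powr p"
    using p by (simp add: mult_le_cancel_right1)
  moreover have "y powr p = 0" using True by simp
  ultimately show ?thesis by linarith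
next
  case False
  have "p * c powr (p - 1) * (y - c) \<le> y powr p - c powr p"
  proof (rule convex_on_imp_above_tangent[OF powr_convex[OF p]])
    show "((\<lambda>x. x powr p) has_real_derivative p * c powr (p - 1)) (at c within {0<..})"
      using c by (auto intro!: derivative_eq_intros)
  qed (use c y False in \<open>auto simp: interior_open\<close>)
  then show ?thesis by simp
qed

text \<open>Jensen's inequality for the measure with density \<open>\<bar>k\<bar>\<close>, via the tangent of \<open>y powr p\<close> at the
  mean. If the product on the left is not integrable, then its integral is \<open>0\<close> by convention.\<close>

lemma powr_integral_mult_le:
  fixes k g :: "'a \<Rightarrow> real"
  assumes k: "integrable M k" and g[measurable]: "g \<in> borel_measurable M" and p: "1 \<le> p"
  shows "ennreal (\<bar>\<integral>u. k u * g u \<partial>M\<bar> powr p)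
    \<le> ennreal ((\<integral>u. \<bar>k u\<bar> \<partial>M) powr (p - 1)) * (\<integral>\<^sup>+ u. ennreal (\<bar>k u\<bar> * \<bar>g u\<bar> powr p) \<partial>M)"
proof -
  have [measurable]: "k \<in> borel_measurable M" using k by auto
  define \<kappa> where "\<kappa> = (\<integral>u. \<bar>k u\<bar> \<partial>M)"
  \<comment> \<open>The mean of |g| under the probability density |k|/\<kappa>, and the point of
    tangency. A tangent needs \<open>l > 0\<close>, which is why a vanishing integral is split
    off.\<close>
  define l where "l = (\<integral>u. \<bar>k u\<bar> * \<bar>g u\<bar> \<partial>M) / \<kappa>"
  have \<kappa>0: "0 \<le> \<kappa>" by (simp add: \<kappa>_def)
  have l0: "0 \<le> l" unfolding l_def using \<kappa>0 by (intro divide_nonneg_nonneg integral_nonneg_AE) auto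
  show ?thesis
  proof (cases "integrable M (\<lambda>u. k u * g u) \<and> (\<integral>u. k u * g u \<partial>M) \<noteq> 0")
    case True
    then have i1: "integrable M (\<lambda>u. \<bar>k u\<bar> * \<bar>g u\<bar>)"
      using integrable_abs[of M "\<lambda>u. k u * g u"] by (simp add: abs_mult)
    have \<kappa>: "\<kappa> > 0"
    proof (rule ccontr)
      assume "\<not> \<kappa> > 0"
      then have "(\<integral>u. \<bar>k u\<bar> \<partial>M) = 0" using \<kappa>0 \<kappa>_def by linarith
      then have "AE u in M. k u = 0"
        using k by (subst (asm) integral_nonneg_eq_0_iff_AE) auto
      then have "(\<integral>u. k u * g u \<partial>M) = (\<integral>u. 0 \<partial>M)"
        by (intro integral_cong_AE) (auto elim!: eventually_mono)
      with True show False by simp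
    qed
    have kl: "\<kappa> * l = (\<integral>u. \<bar>k u\<bar> * \<bar>g u\<bar> \<partial>M)" using \<kappa> by (simp add: l_def)
    have le: "\<bar>\<integral>u. k u * g u \<partial>M\<bar> \<le> \<kappa> * l"
      unfolding kl using integral_abs_bound[of M "\<lambda>u. k u * g u"] by (simp add: abs_mult)
    with True \<kappa> l0 have l: "l > 0" by (cases "l = 0") auto
    show ?thesis
    proof (cases "(\<integral>\<^sup>+ u. ennreal (\<bar>k u\<bar> * \<bar>g u\<bar> powr p) \<partial>M) = \<infinity>")
      case inf: True
      then show ?thesis using \<kappa> by (simp flip: \<kappa>_def add: ennreal_mult_top)
    next
      case False
      then have i2: "integrable M (\<lambda>u. \<bar>k u\<bar> * \<bar>g u\<bar> powr p)"
        by (intro integrableI_nonneg) (auto simp: top.not_eq_extremum)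
      \<comment> \<open>Integrated against |k|, the tangent line gives exactly this value, because
        |g| - l integrates to zero.\<close>
      have "\<kappa> * l powr p = (\<integral>u. (l powr p - p * l powr (p - 1) * l) * \<bar>k u\<bar> + (p * l powr (p - 1)) * (\<bar>k u\<bar> * \<bar>g u\<bar>) \<partial>M)"
      proof -
        have "(\<integral>u. (l powr p - p * l powr (p - 1) * l) * \<bar>k u\<bar> + (p * l powr (p - 1)) * (\<bar>k u\<bar> * \<bar>g u\<bar>) \<partial>M)
            = (\<integral>u. (l powr p - p * l powr (p - 1) * l) * \<bar>k u\<bar> \<partial>M)
              + (\<integral>u. (p * l powr (p - 1)) * (\<bar>k u\<bar> * \<bar>g u\<bar>) \<partial>M)"
          using k i1 by (intro Bochner_Integration.integral_add integrable_mult_right integrable_abs)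
        also have "\<dots> = (l powr p - p * l powr (p - 1) * l) * \<kappa> + (p * l powr (p - 1)) * (\<kappa> * l)"
          by (simp only: integral_mult_right_zero \<kappa>_def[symmetric] kl[symmetric])
        finally show ?thesis by (simp add: algebra_simps)
      qed
      also have "\<dots> \<le> (\<integral>u. \<bar>k u\<bar> * \<bar>g u\<bar> powr p \<partial>M)"
      proof (intro integral_mono i2)
        fix u
        have "(l powr p + p * l powr (p - 1) * (\<bar>g u\<bar> - l)) * \<bar>k u\<bar> \<le> \<bar>g u\<bar> powr p * \<bar>k u\<bar>"
          by (intro mult_right_mono powr_ge_tangent p l) auto
        then show "(l powr p - p * l powr (p - 1) * l) * \<bar>k u\<bar> + (p * l powr (p - 1)) * (\<bar>k u\<bar> * \<bar>g u\<bar>)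
            \<le> \<bar>k u\<bar> * \<bar>g u\<bar> powr p"
          by (simp add: algebra_simps)
      qed (use k i1 in \<open>intro Bochner_Integration.integrable_add integrable_mult_right integrable_abs; simp\<close>)
      finally have "\<kappa> powr (p - 1) * (\<kappa> * l powr p) \<le> \<kappa> powr (p - 1) * (\<integral>u. \<bar>k u\<bar> * \<bar>g u\<bar> powr p \<partial>M)"
        by (intro mult_left_mono) auto
      moreover have "\<kappa> powr (p - 1) * (\<kappa> * l powr p) = (\<kappa> * l) powr p"
        using \<kappa> l by (simp add: powr_mult powr_diff)
      moreover have "\<bar>\<integral>u. k u * g u \<partial>M\<bar> powr p \<le> (\<kappa> * l) powr p"
        using p by (intro powr_mono2 le) auto
      ultimately have "\<bar>\<integral>u. k u * g u \<partial>M\<bar> powr p \<le> \<kappa> powr (p - 1) * (\<integral>u. \<bar>k u\<bar> * \<bar>g u\<bar> powr p \<partial>M)"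
        by linarith
      then have "ennreal (\<bar>\<integral>u. k u * g u \<partial>M\<bar> powr p)
          \<le> ennreal (\<kappa> powr (p - 1)) * ennreal (\<integral>u. \<bar>k u\<bar> * \<bar>g u\<bar> powr p \<partial>M)"
        by (simp flip: ennreal_mult add: ennreal_leI)
      then show ?thesis
        unfolding \<kappa>_def by (subst nn_integral_eq_integral[OF i2]) auto
    qed
  qed (auto simp: not_integrable_integral_eq)
qed

text \<open>Young's inequality for L^1 against L^p, by Jensen's inequality at each x, Tonelli and
  translation invariance. The parameter u may range over any sigma-finite space: it will be a point
  of R^d with shift h u for the mean of the estimator, and a pair (u, t) with shift t u for the
  Taylor remainder.\<close>

lemma nn_integral_shift_average_powr_le:
  fixes k :: "'b \<Rightarrow> real" and G :: "'a::euclidean_space \<Rightarrow> real"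
  assumes "sigma_finite_measure M"
    and k: "integrable M k" and G[measurable]: "G \<in> borel_measurable borel"
    and \<tau>[measurable]: "\<tau> \<in> borel_measurable M" and p: "1 \<le> p"
  shows "(\<integral>\<^sup>+ x. ennreal (\<bar>\<integral>u. k u * G (x + \<tau> u) \<partial>M\<bar> powr p) \<partial>lborel)
    \<le> ennreal ((\<integral>u. \<bar>k u\<bar> \<partial>M) powr p) * Lp_norm_pow p G"
proof -
  interpret M: sigma_finite_measure M by fact
  interpret P: pair_sigma_finite lborel M by standard
  have [measurable]: "k \<in> borel_measurable M" using k by auto
  define \<kappa> where "\<kappa> = (\<integral>u. \<bar>k u\<bar> \<partial>M)"
  have \<kappa>0: "0 \<le> \<kappa>" by (simp add: \<kappa>_def)
  have "(\<integral>\<^sup>+ x. ennreal (\<bar>\<integral>u. k u * G (x + \<tau> u) \<partial>M\<bar> powr p) \<partial>lborel)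
      \<le> (\<integral>\<^sup>+ x. ennreal (\<kappa> powr (p - 1)) * (\<integral>\<^sup>+ u. ennreal (\<bar>k u\<bar> * \<bar>G (x + \<tau> u)\<bar> powr p) \<partial>M) \<partial>lborel)"
    unfolding \<kappa>_def by (intro nn_integral_mono powr_integral_mult_le k p) auto
  also have "\<dots> = ennreal (\<kappa> powr (p - 1)) * (\<integral>\<^sup>+ x. (\<integral>\<^sup>+ u. ennreal (\<bar>k u\<bar> * \<bar>G (x + \<tau> u)\<bar> powr p) \<partial>M) \<partial>lborel)"
    by (intro nn_integral_cmult) measurable
  also have "(\<integral>\<^sup>+ x. (\<integral>\<^sup>+ u. ennreal (\<bar>k u\<bar> * \<bar>G (x + \<tau> u)\<bar> powr p) \<partial>M) \<partial>lborel)
      = (\<integral>\<^sup>+ u. (\<integral>\<^sup>+ x. ennreal (\<bar>k u\<bar> * \<bar>G (x + \<tau> u)\<bar> powr p) \<partial>lborel) \<partial>M)"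
    by (rule P.Fubini'[symmetric]) measurable
  also have "\<dots> = (\<integral>\<^sup>+ u. ennreal \<bar>k u\<bar> * Lp_norm_pow p G \<partial>M)"
  proof (intro nn_integral_cong)
    fix u
    have "(\<integral>\<^sup>+ x. ennreal (\<bar>k u\<bar> * \<bar>G (x + \<tau> u)\<bar> powr p) \<partial>lborel)
        = ennreal \<bar>k u\<bar> * (\<integral>\<^sup>+ x. ennreal (\<bar>G (x + \<tau> u)\<bar> powr p) \<partial>lborel)"
      by (simp add: ennreal_mult nn_integral_cmult)
    also have "(\<integral>\<^sup>+ x. ennreal (\<bar>G (x + \<tau> u)\<bar> powr p) \<partial>lborel) = Lp_norm_pow p G"
      unfolding Lp_norm_pow_def
      by (rule nn_integral_lborel_translate[of "\<lambda>x. ennreal (\<bar>G x\<bar> powr p)"]) measurable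
    finally show "(\<integral>\<^sup>+ x. ennreal (\<bar>k u\<bar> * \<bar>G (x + \<tau> u)\<bar> powr p) \<partial>lborel) = ennreal \<bar>k u\<bar> * Lp_norm_pow p G" .
  qed
  also have "\<dots> = ennreal \<kappa> * Lp_norm_pow p G"
    unfolding \<kappa>_def using k by (simp add: nn_integral_multc nn_integral_eq_integral)
  also have "ennreal (\<kappa> powr (p - 1)) * (ennreal \<kappa> * Lp_norm_pow p G) = ennreal (\<kappa> powr p) * Lp_norm_pow p G"
  proof -
    have "\<kappa> powr (p - 1) * \<kappa> = \<kappa> powr p"
      using \<kappa>0 by (cases "\<kappa> = 0") (auto simp: powr_diff)
    then show ?thesis
      using \<kappa>0 by (simp flip: mult.assoc ennreal_mult)
  qed
  finally show ?thesis by (simp add: \<kappa>_def)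
qed

text \<open>Under the integral the shift moves from \<open>G\<close> to \<open>\<phi>\<close>. All
  three claims rest on integrability over the product space, for which y <= 1 + y^p replaces
  Hoelder's inequality: |G \<phi>| is dominated by |\<phi>| + B |G|^p, whose integral does not
  change when \<open>G\<close> is shifted.\<close>

lemma
  fixes k :: "'b \<Rightarrow> real" and G \<phi> :: "'a::euclidean_space \<Rightarrow> real"
  assumes "sigma_finite_measure M"
    and k: "integrable M k" and G: "in_Lp p G"
    and \<tau>[measurable]: "\<tau> \<in> borel_measurable M" and p: "1 \<le> p"
    and \<phi>: "integrable lborel \<phi>" and bound: "\<And>x. \<bar>\<phi> x\<bar> \<le> B"
    and [measurable]: "\<phi> \<in> borel_measurable borel"
  shows integrable_shift_average_mult:
      "integrable lborel (\<lambda>x. (\<integral>u. k u * G (x + \<tau> u) \<partial>M) * \<phi> x)"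
    and integral_shift_average_mult:
      "(\<integral>x. (\<integral>u. k u * G (x + \<tau> u) \<partial>M) * \<phi> x \<partial>lborel)
        = (\<integral>u. k u * (\<integral>x. G x * \<phi> (x - \<tau> u) \<partial>lborel) \<partial>M)"
    and integrable_mult_shift_integral:
      "integrable M (\<lambda>u. k u * (\<integral>x. G x * \<phi> (x - \<tau> u) \<partial>lborel))"
proof -
  interpret M: sigma_finite_measure M by fact
  interpret P: pair_sigma_finite lborel M by standard
  have [measurable]: "k \<in> borel_measurable M" using k by auto
  have [measurable]: "G \<in> borel_measurable borel" using G by (simp add: in_Lp_def)
  have B: "0 \<le> B" using bound[of 0] by linarith
  define C where "C = ennreal (\<integral>x. \<bar>\<phi> x\<bar> \<partial>lborel) + ennreal B * Lp_norm_pow p G"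
  have C: "C < \<infinity>"
    using G by (auto simp: C_def in_Lp_def ennreal_mult_less_top)
  have bd: "(\<integral>\<^sup>+ x. ennreal (\<bar>G (x + v)\<bar> * \<bar>\<phi> x\<bar>) \<partial>lborel) \<le> C" for v
  proof -
    have "(\<integral>\<^sup>+ x. ennreal (\<bar>G (x + v)\<bar> * \<bar>\<phi> x\<bar>) \<partial>lborel)
        \<le> (\<integral>\<^sup>+ x. ennreal \<bar>\<phi> x\<bar> + ennreal B * ennreal (\<bar>G (x + v)\<bar> powr p) \<partial>lborel)"
    proof (intro nn_integral_mono)
      fix x
      have "\<bar>G (x + v)\<bar> \<le> 1 + \<bar>G (x + v)\<bar> powr p"
      proof (cases "\<bar>G (x + v)\<bar> \<le> 1")
        case False
        then have "\<bar>G (x + v)\<bar> powr 1 \<le> \<bar>G (x + v)\<bar> powr p"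
          using p by (intro powr_mono) auto
        then show ?thesis by simp
      qed (simp add: add_increasing2)
      then have "\<bar>G (x + v)\<bar> * \<bar>\<phi> x\<bar> \<le> (1 + \<bar>G (x + v)\<bar> powr p) * \<bar>\<phi> x\<bar>"
        by (intro mult_right_mono) auto
      also have "\<dots> \<le> \<bar>\<phi> x\<bar> + B * \<bar>G (x + v)\<bar> powr p"
        using mult_right_mono[OF bound[of x], of "\<bar>G (x + v)\<bar> powr p"] by (simp add: algebra_simps)
      finally show "ennreal (\<bar>G (x + v)\<bar> * \<bar>\<phi> x\<bar>) \<le> ennreal \<bar>\<phi> x\<bar> + ennreal B * ennreal (\<bar>G (x + v)\<bar> powr p)"
        using B by (simp flip: ennreal_plus ennreal_mult add: ennreal_leI)
    qed
    also have "\<dots> = ennreal (\<integral>x. \<bar>\<phi> x\<bar> \<partial>lborel) + ennreal B * (\<integral>\<^sup>+ x. ennreal (\<bar>G (x + v)\<bar> powr p) \<partial>lborel)"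
      using \<phi> by (simp add: nn_integral_add nn_integral_cmult nn_integral_eq_integral)
    also have "(\<integral>\<^sup>+ x. ennreal (\<bar>G (x + v)\<bar> powr p) \<partial>lborel) = Lp_norm_pow p G"
      unfolding Lp_norm_pow_def
      by (rule nn_integral_lborel_translate[of "\<lambda>x. ennreal (\<bar>G x\<bar> powr p)"]) measurable
    finally show ?thesis by (simp add: C_def)
  qed
  have int: "integrable (lborel \<Otimes>\<^sub>M M) (\<lambda>(x, u). k u * G (x + \<tau> u) * \<phi> x)"
  proof (rule integrableI_bounded)
    have "(\<integral>\<^sup>+ z. ennreal (norm (case z of (x, u) \<Rightarrow> k u * G (x + \<tau> u) * \<phi> x)) \<partial>(lborel \<Otimes>\<^sub>M M))
        = (\<integral>\<^sup>+ u. (\<integral>\<^sup>+ x. ennreal (norm (k u * G (x + \<tau> u) * \<phi> x)) \<partial>lborel) \<partial>M)"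
      by (subst P.nn_integral_snd[symmetric]) (auto simp: split_beta')
    also have "\<dots> = (\<integral>\<^sup>+ u. ennreal \<bar>k u\<bar> * (\<integral>\<^sup>+ x. ennreal (\<bar>G (x + \<tau> u)\<bar> * \<bar>\<phi> x\<bar>) \<partial>lborel) \<partial>M)"
      by (intro nn_integral_cong) (simp add: abs_mult mult.assoc ennreal_mult' nn_integral_cmult)
    also have "\<dots> \<le> (\<integral>\<^sup>+ u. ennreal \<bar>k u\<bar> * C \<partial>M)"
      by (intro nn_integral_mono mult_left_mono bd) auto
    also have "\<dots> = ennreal (\<integral>u. \<bar>k u\<bar> \<partial>M) * C"
      using k by (simp add: nn_integral_multc nn_integral_eq_integral)
    also have "\<dots> < \<infinity>" using C by (simp add: ennreal_mult_less_top)
    finally show "(\<integral>\<^sup>+ z. ennreal (norm (case z of (x, u) \<Rightarrow> k u * G (x + \<tau> u) * \<phi> x)) \<partial>(lborel \<Otimes>\<^sub>M M)) < \<infinity>" .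
  qed measurable
  have eq: "(\<integral>x. k u * G (x + \<tau> u) * \<phi> x \<partial>lborel) = k u * (\<integral>x. G x * \<phi> (x - \<tau> u) \<partial>lborel)" for u
    using lborel_integral_translate[of "\<lambda>x. G x * \<phi> (x - \<tau> u)" "\<tau> u"] by (simp add: mult.assoc)
  have eq': "(\<integral>u. k u * G (x + \<tau> u) * \<phi> x \<partial>M) = (\<integral>u. k u * G (x + \<tau> u) \<partial>M) * \<phi> x" for x
    by simp
  show "integrable lborel (\<lambda>x. (\<integral>u. k u * G (x + \<tau> u) \<partial>M) * \<phi> x)"
    using P.integrable_fst[OF int] by simp
  show "integrable M (\<lambda>u. k u * (\<integral>x. G x * \<phi> (x - \<tau> u) \<partial>lborel))"
    using P.integrable_snd[OF int] by (simp add: eq)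
  show "(\<integral>x. (\<integral>u. k u * G (x + \<tau> u) \<partial>M) * \<phi> x \<partial>lborel)
        = (\<integral>u. k u * (\<integral>x. G x * \<phi> (x - \<tau> u) \<partial>lborel) \<partial>M)"
    using P.Fubini_integral[OF int] by (simp add: eq)
qed

section \<open>Test functions and the fundamental lemma\<close>

text \<open>The functions behind the classical bump exp(-1/t). With a polynomial in 1/t as a
  parameter the family is closed under differentiation, so a single derivative formula yields
  smoothness of all orders.\<close>

definition flat :: "real poly \<Rightarrow> real \<Rightarrow> real" where
  "flat P t = (if t \<le> 0 then 0 else poly P (1 / t) * exp (- (1 / t)))"

lemma tendsto_poly_mult_exp_minus: "((\<lambda>x. poly P x * exp (- x)) \<longlongrightarrow> 0) at_top" for P :: "real poly"
proof -
  have "((\<lambda>x. \<Sum>i\<le>degree P. coeff P i * (x ^ i / exp x)) \<longlongrightarrow> (\<Sum>i\<le>degree P. coeff P i * 0)) at_top"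
    by (intro tendsto_sum tendsto_mult tendsto_const tendsto_power_div_exp_0)
  moreover have "(\<Sum>i\<le>degree P. coeff P i * (x ^ i / exp x)) = poly P x * exp (- x)" for x
    unfolding poly_altdef sum_distrib_right by (intro sum.cong) (auto simp: exp_minus field_simps)
  ultimately show ?thesis by simp
qed

lemma flat_tendsto_0: "(flat P \<longlongrightarrow> 0) (at 0)"
proof (rule filterlim_split_at_real)
  show "(flat P \<longlongrightarrow> 0) (at_left 0)"
    by (rule tendsto_eventually) (auto simp: flat_def eventually_at_left_real eventually_at_filter)
  have "((\<lambda>t. poly P (inverse t) * exp (- inverse t)) \<longlongrightarrow> 0) (at_right 0)"
    by (rule filterlim_compose[OF tendsto_poly_mult_exp_minus filterlim_inverse_at_top_right])
  then show "(flat P \<longlongrightarrow> 0) (at_right 0)"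
    by (rule Lim_transform_eventually) (auto simp: flat_def eventually_at_filter inverse_eq_divide)
qed

text \<open>With X = 1/t one has dX/dt = -X^2, so P(X) exp(-X) has the derivative X^2 (P - P')(X)
  exp(-X); \<open>[:0, 0, 1:]\<close> is X^2. At t = 0 the difference quotient is
  \<open>flat ([:0, 1:] * P)\<close>, again a member of the family, and tends to 0.\<close>

lemma has_real_derivative_flat:
  "(flat P has_real_derivative flat ([:0, 0, 1:] * (P - pderiv P)) t) (at t)"
proof -
  consider "t < 0" | "t > 0" | "t = 0" by linarith
  then show ?thesis
  proof cases
    case 1
    have "((\<lambda>_. 0) has_real_derivative 0) (at t)" by simp
    then have "(flat P has_real_derivative 0) (at t)"
      by (rule DERIV_cong_ev[THEN iffD1, rotated -1])
         (use 1 eventually_nhds_in_open[of "{..<0}" t] in \<open>auto simp: flat_def elim!: eventually_mono\<close>)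
    then show ?thesis using 1 by (simp add: flat_def)
  next
    case 2
    have "((\<lambda>t. poly P (1 / t) * exp (- (1 / t))) has_real_derivative
        poly ([:0, 0, 1:] * (P - pderiv P)) (1 / t) * exp (- (1 / t))) (at t)"
      using 2 by (auto intro!: derivative_eq_intros poly_DERIV[THEN DERIV_chain2]
          simp: algebra_simps power2_eq_square)
    then have "(flat P has_real_derivative poly ([:0, 0, 1:] * (P - pderiv P)) (1 / t) * exp (- (1 / t))) (at t)"
      by (rule DERIV_cong_ev[THEN iffD1, rotated -1])
         (use 2 eventually_nhds_in_open[of "{0<..}" t] in \<open>auto simp: flat_def elim!: eventually_mono\<close>)
    then show ?thesis using 2 by (simp add: flat_def)
  next
    case 3
    have "(flat ([:0, 1:] * P) \<longlongrightarrow> 0) (at 0)" by (rule flat_tendsto_0)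
    then have "((\<lambda>h. (flat P (0 + h) - flat P 0) / h) \<longlongrightarrow> 0) (at 0)"
      by (rule Lim_transform_eventually) (auto simp: flat_def eventually_at_filter)
    then show ?thesis using 3 by (simp add: flat_def DERIV_def)
  qed
qed

text \<open>An algebra of smooth functions that is visibly closed under partial derivatives.\<close>

inductive_set smooth_algebra :: "(real^'d::finite \<Rightarrow> real) set" where
  flat: "(\<lambda>x. flat P (a * x $ i + b)) \<in> smooth_algebra"
| const: "(\<lambda>_. c) \<in> smooth_algebra"
| add: "f \<in> smooth_algebra \<Longrightarrow> g \<in> smooth_algebra \<Longrightarrow> (\<lambda>x. f x + g x) \<in> smooth_algebra"
| mult: "f \<in> smooth_algebra \<Longrightarrow> g \<in> smooth_algebra \<Longrightarrow> (\<lambda>x. f x * g x) \<in> smooth_algebra"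

lemma partial_deriv_eqI:
  assumes "\<And>x. (f has_derivative D x) (at x)"
  shows "partial_deriv i f = (\<lambda>x. D x (axis i 1))"
  using frechet_derivative_at[OF assms] by (auto simp: partial_deriv_def fun_eq_iff)

lemma smooth_algebra_partial_deriv:
  fixes f :: "real^'d::finite \<Rightarrow> real"
  shows "f \<in> smooth_algebra \<Longrightarrow> (\<forall>x. f differentiable (at x)) \<and> (\<forall>i. partial_deriv i f \<in> smooth_algebra)"
proof (induction rule: smooth_algebra.induct)
  case (flat P a j b)
  let ?Q = "[:0, 0, 1:] * (P - pderiv P)"
  have D: "((\<lambda>x. flat P (a * x $ j + b)) has_derivative (\<lambda>v. v $ j * a * flat ?Q (a * x $ j + b))) (at x)"
    for x :: "real^'d"
    using has_real_derivative_flat[of P "a * x $ j + b"]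
    by (auto intro!: derivative_eq_intros DERIV_compose_FDERIV[of "flat P"] bounded_linear.has_derivative[OF bounded_linear_vec_nth]
        simp del: mult_pCons_left)
  have "partial_deriv i (\<lambda>x::real^'d. flat P (a * x $ j + b)) \<in> smooth_algebra" for i
    unfolding partial_deriv_eqI[OF D]
    by (intro smooth_algebra.intros)
  with D show ?case by (auto simp: differentiable_def)
next
  case (const c)
  have "((\<lambda>x::real^'d. c) has_derivative (\<lambda>_. 0)) (at x)" for x by simp
  from partial_deriv_eqI[OF this] show ?case by (auto intro: smooth_algebra.intros)
next
  case (add f g)
  then have "((\<lambda>x. f x + g x) has_derivative
      (\<lambda>v. frechet_derivative f (at x) v + frechet_derivative g (at x) v)) (at x)" for x
    by (intro has_derivative_add) (auto simp: frechet_derivative_works[symmetric])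
  from partial_deriv_eqI[OF this] add show ?case
    by (auto simp flip: partial_deriv_def intro!: smooth_algebra.add)
next
  case (mult f g)
  then have "((\<lambda>x. f x * g x) has_derivative
      (\<lambda>v. f x * frechet_derivative g (at x) v + frechet_derivative f (at x) v * g x)) (at x)" for x
    by (intro has_derivative_mult) (auto simp: frechet_derivative_works[symmetric])
  from partial_deriv_eqI[OF this] mult show ?case
    by (auto simp flip: partial_deriv_def intro!: smooth_algebra.add smooth_algebra.mult)
qed

lemma smooth_algebra_iter_partial:
  "f \<in> smooth_algebra \<Longrightarrow> iter_partial is f \<in> smooth_algebra"
  by (induction "is") (auto simp: iter_partial_def smooth_algebra_partial_deriv)

lemma smooth_algebra_prod:
  "finite I \<Longrightarrow> (\<And>i. i \<in> I \<Longrightarrow> f i \<in> smooth_algebra) \<Longrightarrow> (\<lambda>x. \<Prod>i\<in>I. f i x) \<in> smooth_algebra"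
  by (induction I rule: finite_induct) (auto intro: smooth_algebra.intros)

lemma smooth_algebra_test_function:
  assumes "f \<in> smooth_algebra" "bounded {x. f x \<noteq> 0}"
  shows "test_function f"
  using assms smooth_algebra_iter_partial smooth_algebra_partial_deriv
  by (auto simp: test_function_def compact_closure)

section \<open>Smooth approximations of the indicators of boxes\<close>

lemma flat_1_bounds: "0 \<le> flat 1 t" "flat 1 t \<le> 1" "t \<le> 0 \<Longrightarrow> flat 1 t = 0"
  by (auto simp: flat_def)

lemma flat_1_tendsto: "(\<lambda>n. flat 1 (real (Suc n) * t)) \<longlonglongrightarrow> (if t > 0 then 1 else 0)"
proof (cases "t > 0")
  case True
  have "(\<lambda>n. exp (- (1 / t * inverse (real (Suc n))))) \<longlonglongrightarrow> exp (- (1 / t * 0))"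
    by (intro tendsto_intros LIMSEQ_inverse_real_of_nat)
  moreover have "flat 1 (real (Suc n) * t) = exp (- (1 / t * inverse (real (Suc n))))" for n
  proof -
    have "0 < real (Suc n) * t" using True by (intro mult_pos_pos) auto
    then have "\<not> real (Suc n) * t \<le> 0" by linarith
    then show ?thesis unfolding flat_def using True by (simp del: of_nat_Suc add: field_simps)
  qed
  ultimately show ?thesis using True by simp
next
  case False
  have "flat 1 (real (Suc n) * t) = 0" for n
    using False by (intro flat_1_bounds) (simp add: mult_le_0_iff)
  then show ?thesis using False by simp
qed

text \<open>Dilation makes each factor tend to the indicator of an open half-space, so the product
  tends to the indicator of the open box while staying below it, as dominated convergence
  requires.\<close>

definition box_bump :: "real^'d::finite \<Rightarrow> real^'d \<Rightarrow> nat \<Rightarrow> real^'d \<Rightarrow> real" where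
  "box_bump a b n x = (\<Prod>i\<in>UNIV. flat 1 (real (Suc n) * (x $ i - a $ i)) * flat 1 (real (Suc n) * (b $ i - x $ i)))"

lemma box_bump_bounds: "0 \<le> box_bump a b n x" "box_bump a b n x \<le> 1"
  unfolding box_bump_def by (auto intro!: prod_nonneg prod_le_1 mult_le_one mult_nonneg_nonneg flat_1_bounds
      simp del: of_nat_Suc)

lemma box_bump_eq_0: "x \<notin> box a b \<Longrightarrow> box_bump a b n x = 0"
proof -
  assume "x \<notin> box a b"
  then obtain i where "x $ i \<le> a $ i \<or> b $ i \<le> x $ i" by (auto simp: mem_box_cart not_less)
  then have "flat 1 (real (Suc n) * (x $ i - a $ i)) * flat 1 (real (Suc n) * (b $ i - x $ i)) = 0"
    by (auto intro!: flat_1_bounds simp: mult_le_0_iff)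
  then show ?thesis unfolding box_bump_def by (intro prod_zero) auto
qed

lemma box_bump_tendsto: "(\<lambda>n. box_bump a b n x) \<longlonglongrightarrow> indicator (box a b) x"
proof (cases "x \<in> box a b")
  case True
  have "(\<lambda>n. box_bump a b n x) \<longlonglongrightarrow> (\<Prod>i\<in>UNIV. (if x $ i - a $ i > 0 then 1 else 0) * (if b $ i - x $ i > 0 then 1 else 0))"
    unfolding box_bump_def by (intro tendsto_prod tendsto_mult flat_1_tendsto)
  also have "(\<Prod>i\<in>UNIV. (if x $ i - a $ i > 0 then 1 else 0) * (if b $ i - x $ i > 0 then 1 else 0)) = (1::real)"
    using True by (auto simp: mem_box_cart intro!: prod.neutral)
  finally show ?thesis using True by simp
qed (simp add: box_bump_eq_0)

lemma test_function_box_bump: "test_function (box_bump a b n)"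
proof (rule smooth_algebra_test_function)
  have "(\<lambda>x. flat 1 (real (Suc n) * x $ i + - real (Suc n) * a $ i) * flat 1 (- real (Suc n) * x $ i + real (Suc n) * b $ i))
      \<in> smooth_algebra" for i
    by (intro smooth_algebra.intros)
  then show "box_bump a b n \<in> smooth_algebra"
    unfolding box_bump_def [abs_def] by (intro smooth_algebra_prod) (auto simp: algebra_simps)
  show "bounded {x. box_bump a b n x \<noteq> 0}"
    by (rule bounded_subset[OF bounded_box[of a b]]) (use box_bump_eq_0 in blast)
qed

lemma test_function_continuous: "test_function \<phi> \<Longrightarrow> continuous_on UNIV (iter_partial is \<phi>)"
  by (auto simp: test_function_def intro!: continuous_at_imp_continuous_on differentiable_imp_continuous_within)

text \<open>Dominated convergence along \<open>box_bump\<close> turns the hypothesis into vanishing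
  integrals over all boxes. Boxes are stable under intersection and generate the Borel sets, so the
  positive and the negative part of \<open>w\<close> are densities of the same measure.\<close>

lemma fundamental_lemma_calculus_of_variations:
  fixes w :: "real^'d::finite \<Rightarrow> real"
  assumes w: "locally_integrable w"
    and zero: "\<And>\<phi>. test_function \<phi> \<Longrightarrow> (\<integral>x. w x * \<phi> x \<partial>lborel) = 0"
  shows "AE x in lborel. w x = 0"
proof -
  have [measurable]: "w \<in> borel_measurable borel" using w by (simp add: locally_integrable_def)
  have int: "integrable lborel (\<lambda>x. w x * indicator (box a b) x)" for a b
  proof -
    have "set_integrable lborel (cbox a b) w"
      using w by (simp add: locally_integrable_def)
    then have "set_integrable lborel (box a b) w"
      by (rule set_integrable_subset) (auto simp: box_subset_cbox)
    then show ?thesis by (simp add: set_integrable_def mult.commute)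
  qed
  have box0: "(\<integral>x. w x * indicator (box a b) x \<partial>lborel) = 0" for a b
  proof -
    have "(\<lambda>n. \<integral>x. w x * box_bump a b n x \<partial>lborel) \<longlonglongrightarrow> (\<integral>x. w x * indicator (box a b) x \<partial>lborel)"
    proof (rule integral_dominated_convergence)
      show "integrable lborel (\<lambda>x. \<bar>w x * indicator (box a b) x\<bar>)"
        by (intro integrable_abs int)
      show "(\<lambda>x. w x * box_bump a b n x) \<in> borel_measurable lborel" for n
        using test_function_continuous[OF test_function_box_bump[of a b n], of "[]"]
        by (auto simp: iter_partial_def dest: borel_measurable_continuous_onI)
      show "AE x in lborel. norm (w x * box_bump a b n x) \<le> \<bar>w x * indicator (box a b) x\<bar>" for n
        using box_bump_bounds[of a b n]
        by (auto simp: abs_mult indicator_def box_bump_eq_0 mult_left_le)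
    qed (auto intro!: tendsto_mult box_bump_tendsto)
    then show ?thesis by (simp add: zero test_function_box_bump LIMSEQ_const_iff)
  qed
  \<comment> \<open>\<open>ennreal\<close> sends negative numbers to 0, so these are the measures
    whose densities are the positive and the negative part of \<open>w\<close>.\<close>
  let ?M = "density lborel (\<lambda>x. ennreal (w x))" and ?N = "density lborel (\<lambda>x. ennreal (- w x))"
  have fin: "emeasure ?M (box a b) < \<infinity>" and eq: "emeasure ?M (box a b) = emeasure ?N (box a b)" for a b
  proof -
    note i = int[of a b]
    have 1: "(\<integral>\<^sup>+ x. ennreal (w x * indicator (box a b) x) \<partial>lborel) < \<infinity>"
      "(\<integral>\<^sup>+ x. ennreal (- (w x * indicator (box a b) x)) \<partial>lborel) < \<infinity>"
      using i unfolding real_integrable_def by (auto simp: top.not_eq_extremum)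
    have 2: "emeasure ?M (box a b) = (\<integral>\<^sup>+ x. ennreal (w x * indicator (box a b) x) \<partial>lborel)"
      "emeasure ?N (box a b) = (\<integral>\<^sup>+ x. ennreal (- (w x * indicator (box a b) x)) \<partial>lborel)"
      by (auto simp: emeasure_density indicator_def intro!: nn_integral_cong)
    from 1 2 show "emeasure ?M (box a b) < \<infinity>" by simp
    have "enn2real (\<integral>\<^sup>+ x. ennreal (w x * indicator (box a b) x) \<partial>lborel)
        = enn2real (\<integral>\<^sup>+ x. ennreal (- (w x * indicator (box a b) x)) \<partial>lborel)"
      using real_lebesgue_integral_def[OF i] box0[of a b] by simp
    then show "emeasure ?M (box a b) = emeasure ?N (box a b)"
      using 1 unfolding 2 by (metis ennreal_enn2real infinity_ennreal_def)
  qed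
  have "?M = ?N"
  proof (rule measure_eqI_generator_eq)
    let ?E = "range (\<lambda>(a, b). box a b :: (real^'d) set)"
    show "Int_stable ?E" by (auto simp: Int_stable_def box_Int_box)
    show "?E \<subseteq> Pow UNIV" "sets ?M = sigma_sets UNIV ?E" "sets ?N = sigma_sets UNIV ?E"
      by (simp_all add: borel_eq_box)
    let ?A = "\<lambda>n::nat. box (- (real n *\<^sub>R One)) (real n *\<^sub>R One) :: (real^'d) set"
    show "range ?A \<subseteq> ?E" "(\<Union>i. ?A i) = UNIV"
      unfolding UN_box_eq_UNIV by auto
    show "emeasure ?M (?A i) \<noteq> \<infinity>" for i using fin by (simp add: less_top)
    show "emeasure ?M X = emeasure ?N X" if "X \<in> ?E" for X using that eq by auto
  qed
  \<comment> \<open>The two parts are never both nonzero at a point, so their equality forces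
    \<open>w x = 0\<close>.\<close>
  then have "AE x in lborel. ennreal (w x) = ennreal (- w x)"
    by (intro sigma_finite_measure.density_unique[OF sigma_finite_lborel]) auto
  then show ?thesis
    by eventually_elim (smt (verit) ennreal_eq_0_iff ennreal_neg)
qed

section \<open>Bias of the kernel estimator\<close>

definition mono_list :: "'d list \<Rightarrow> real^'d::finite \<Rightarrow> real" where
  "mono_list is u = prod_list (map (\<lambda>i. u $ i) is)"

lemma mono_list_simps [simp]: "mono_list [] u = 1" "mono_list (i # is) u = u $ i * mono_list is u"
  by (auto simp: mono_list_def)

lemma measurable_mono_list [measurable]: "mono_list is \<in> borel_measurable borel"
proof (induction "is")
  case Nil
  then show ?case by (simp add: mono_list_def)
next
  case (Cons i "is")
  note [measurable] = Cons
  have "(\<lambda>u. u $ i * mono_list is u) \<in> borel_measurable borel" by measurable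
  then show ?case by (simp add: mono_list_def)
qed

text \<open>Together with \<open>mi_monom_count_list\<close> this carries the hypotheses on kernels
  and weak derivatives, phrased with multi-indices, over to lists; \<open>count_list\<close> sends a
  list to its multi-index.\<close>

lemma mi_order_count_list: "mi_order (count_list is) = length is"
proof (induction "is")
  case Nil
  then show ?case by (simp add: mi_order_def)
next
  case (Cons i "is")
  have "mi_order (count_list (i # is)) = (\<Sum>j\<in>UNIV. count_list is j + (if i = j then 1 else 0))"
    unfolding mi_order_def by (intro sum.cong) auto
  also have "\<dots> = mi_order (count_list is) + 1"
    by (simp add: sum.distrib mi_order_def)
  finally show ?case using Cons by (simp only: list.size)
qed

lemma mi_monom_count_list: "mi_monom (count_list is) u = mono_list is u"
proof (induction "is")
  case Nil
  then show ?case by (simp add: mi_monom_def)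
next
  case (Cons i "is")
  have "mi_monom (count_list (i # is)) u = (\<Prod>j\<in>UNIV. (u $ j) ^ count_list is j * (if i = j then u $ j else 1))"
    unfolding mi_monom_def by (intro prod.cong) auto
  also have "\<dots> = mi_monom (count_list is) u * u $ i"
    by (simp add: prod.distrib mi_monom_def)
  finally show ?case using Cons by (simp only: mono_list_simps mult.commute)
qed

lemma finite_lists_length: "finite {is :: 'd::finite list. length is = k}"
  using finite_lists_length_eq[of "UNIV :: 'd set" k] by simp

text \<open>The new direction is prepended because the head of the list is the outermost derivative
  in \<open>iter_partial\<close>, hence the one that a further differentiation produces.\<close>

lemma sum_lists_length_Suc:
  fixes g :: "'d::finite list \<Rightarrow> 'b::comm_monoid_add"
  shows "(\<Sum>is | length is = Suc k. g is) = (\<Sum>is | length is = k. \<Sum>i\<in>UNIV. g (i # is))"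
proof -
  have "{is :: 'd list. length is = Suc k} = (\<lambda>(is, i). i # is) ` ({is. length is = k} \<times> UNIV)"
    by (auto simp: length_Suc_conv image_iff)
  then have "(\<Sum>is | length is = Suc k. g is) = (\<Sum>(is, i)\<in>{is. length is = k} \<times> UNIV. g (i # is))"
    by (simp only:) (subst sum.reindex, auto simp: inj_on_def split_beta' intro!: sum.cong)
  then show ?thesis by (simp add: sum.cartesian_product)
qed

lemma iter_partial_Nil [simp]: "iter_partial [] \<phi> = \<phi>"
  by (simp add: iter_partial_def)

section \<open>Test functions along lines and Taylor's formula\<close>

text \<open>The chain rule, with u expanded in the basis vectors \<open>axis i 1\<close>. The line
  runs in the direction -u because a shift of f by t u becomes a shift of the test function by -t
  u.\<close>

lemma test_function_line_derivative:
  fixes \<phi> :: "real^'d::finite \<Rightarrow> real"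
  assumes "test_function \<phi>"
  shows "((\<lambda>t. iter_partial is \<phi> (x - t *\<^sub>R u)) has_real_derivative
    - (\<Sum>i\<in>UNIV. u $ i * iter_partial (i # is) \<phi> (x - t *\<^sub>R u))) (at t)"
proof -
  let ?\<psi> = "iter_partial is \<phi>" and ?y = "x - t *\<^sub>R u"
  let ?D = "frechet_derivative ?\<psi> (at ?y)"
  have "?\<psi> differentiable (at ?y)" using assms by (auto simp: test_function_def)
  then have D: "(?\<psi> has_derivative ?D) (at ?y)" by (simp add: frechet_derivative_works)
  interpret D: bounded_linear ?D using D by (rule has_derivative_bounded_linear)
  have "((\<lambda>t. x - t *\<^sub>R u) has_derivative (\<lambda>s. - (s *\<^sub>R u))) (at t)"
    by (auto intro!: derivative_eq_intros)
  from has_derivative_compose[OF this D]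
  have "((\<lambda>t. ?\<psi> (x - t *\<^sub>R u)) has_derivative (\<lambda>s. ?D (- (s *\<^sub>R u)))) (at t)" .
  moreover have "?D (- (s *\<^sub>R u)) = s * - ?D u" for s
    by (simp add: D.neg D.scaleR)
  moreover have "?D u = (\<Sum>i\<in>UNIV. u $ i * ?D (axis i 1))"
  proof -
    have "u = (\<Sum>i\<in>UNIV. u $ i *\<^sub>R axis i 1)"
      by (simp flip: scalar_mult_eq_scaleR add: basis_expansion)
    then have "?D u = ?D (\<Sum>i\<in>UNIV. u $ i *\<^sub>R axis i 1)" by simp
    also have "\<dots> = (\<Sum>i\<in>UNIV. u $ i * ?D (axis i 1))" by (simp add: D.sum D.scaleR)
    finally show ?thesis .
  qed
  ultimately have "((\<lambda>t. ?\<psi> (x - t *\<^sub>R u)) has_derivative (\<lambda>s. s * - (\<Sum>i\<in>UNIV. u $ i * ?D (axis i 1)))) (at t)"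
    by simp
  then have "((\<lambda>t. ?\<psi> (x - t *\<^sub>R u)) has_real_derivative - (\<Sum>i\<in>UNIV. u $ i * ?D (axis i 1))) (at t)"
    by (rule has_derivative_imp_has_field_derivative) simp
  then show ?thesis
    by (simp add: iter_partial_def partial_deriv_def)
qed

text \<open>The complement of the closed support is open, so the function being differentiated
  vanishes near each of its points. Boundedness and integrability of all derivatives then come from
  compactness.\<close>

lemma test_function_iter_partial_zero:
  fixes \<phi> :: "real^'d::finite \<Rightarrow> real"
  assumes "test_function \<phi>" "x \<notin> closure {x. \<phi> x \<noteq> 0}"
  shows "iter_partial is \<phi> x = 0"
  using assms(2)
proof (induction "is" arbitrary: x)
  case Nil
  then show ?case using closure_subset[of "{x. \<phi> x \<noteq> 0}"] by auto
next
  case (Cons i "is")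
  have "((\<lambda>_. 0) has_derivative (\<lambda>_. 0)) (at x)" by simp
  then have "(iter_partial is \<phi> has_derivative (\<lambda>_. 0)) (at x)"
    by (rule has_derivative_transform_within_open[where s = "- closure {x. \<phi> x \<noteq> 0}"])
       (use Cons in auto)
  then have "frechet_derivative (iter_partial is \<phi>) (at x) = (\<lambda>_. 0)"
    by (rule frechet_derivative_at[symmetric])
  then show ?case by (simp add: iter_partial_def partial_deriv_def)
qed

lemma test_function_measurable:
  "test_function \<phi> \<Longrightarrow> iter_partial is \<phi> \<in> borel_measurable borel"
  by (auto dest: test_function_continuous intro: borel_measurable_continuous_onI)

lemma test_function_bounded:
  fixes \<phi> :: "real^'d::finite \<Rightarrow> real"
  assumes "test_function \<phi>"
  obtains B where "\<And>x. \<bar>iter_partial is \<phi> x\<bar> \<le> B"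
proof -
  let ?C = "closure {x. \<phi> x \<noteq> 0}"
  have "compact ?C" using assms by (simp add: test_function_def)
  then have "bounded (iter_partial is \<phi> ` ?C)"
    by (intro compact_imp_bounded compact_continuous_image
        continuous_on_subset[OF test_function_continuous[OF assms] subset_UNIV])
  then obtain B where B: "\<And>x. x \<in> ?C \<Longrightarrow> \<bar>iter_partial is \<phi> x\<bar> \<le> B"
    by (auto simp: bounded_iff)
  have "\<bar>iter_partial is \<phi> x\<bar> \<le> max B 0" for x
    using B[of x] test_function_iter_partial_zero[OF assms, of x] by (cases "x \<in> ?C") auto
  then show thesis by (rule that)
qed

lemma test_function_integrable:
  fixes \<phi> :: "real^'d::finite \<Rightarrow> real"
  assumes "test_function \<phi>"
  shows "integrable lborel (iter_partial is \<phi>)"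
proof -
  let ?C = "closure {x. \<phi> x \<noteq> 0}"
  have "integrable lborel (\<lambda>x. indicator ?C x *\<^sub>R iter_partial is \<phi> x)"
    by (rule borel_integrable_compact[OF _ continuous_on_subset[OF test_function_continuous[OF assms] subset_UNIV]])
       (use assms in \<open>simp add: test_function_def\<close>)
  moreover have "indicator ?C x *\<^sub>R iter_partial is \<phi> x = iter_partial is \<phi> x" for x
    using test_function_iter_partial_zero[OF assms, of x] by (cases "x \<in> ?C") auto
  ultimately show ?thesis by (simp only:)
qed

lemma iter_partial_translate:
  fixes \<phi> :: "real^'d::finite \<Rightarrow> real"
  assumes "test_function \<phi>"
  shows "iter_partial is (\<lambda>x. \<phi> (x - v)) = (\<lambda>x. iter_partial is \<phi> (x - v))"
proof (induction "is")
  case (Cons i "is")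
  have "((\<lambda>x. iter_partial is \<phi> (x - v)) has_derivative frechet_derivative (iter_partial is \<phi>) (at (x - v))) (at x)" for x
  proof -
    have "iter_partial is \<phi> differentiable (at (x - v))" using assms by (auto simp: test_function_def)
    then have D: "(iter_partial is \<phi> has_derivative frechet_derivative (iter_partial is \<phi>) (at (x - v))) (at (x - v))"
      by (simp add: frechet_derivative_works)
    have "((\<lambda>x. x - v) has_derivative (\<lambda>s. s)) (at x)"
      by (auto intro!: derivative_eq_intros)
    from has_derivative_compose[OF this D] show ?thesis .
  qed
  then have "partial_deriv i (\<lambda>x. iter_partial is \<phi> (x - v))
      = (\<lambda>x. frechet_derivative (iter_partial is \<phi>) (at (x - v)) (axis i 1))"
    by (rule partial_deriv_eqI)
  then show ?case
    using Cons by (simp add: iter_partial_def partial_deriv_def)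
qed simp

lemma test_function_translate:
  fixes \<phi> :: "real^'d::finite \<Rightarrow> real"
  assumes "test_function \<phi>"
  shows "test_function (\<lambda>x. \<phi> (x - v))"
  unfolding test_function_def iter_partial_translate[OF assms]
proof (intro conjI allI)
  fix "is" x
  have "iter_partial is \<phi> differentiable (at (x - v))" using assms by (auto simp: test_function_def)
  then show "(\<lambda>x. iter_partial is \<phi> (x - v)) differentiable (at x)"
    using differentiable_chain_at[of "\<lambda>x. x - v" x "iter_partial is \<phi>"] by (simp add: comp_def)
  have "{x. \<phi> (x - v) \<noteq> 0} = (\<lambda>x. v + x) ` {x. \<phi> x \<noteq> 0}"
    by (auto simp: image_iff) (metis add.commute diff_add_cancel)
  then show "compact (closure {x. \<phi> (x - v) \<noteq> 0})"
    using assms by (auto simp: closure_translation test_function_def intro!: compact_translation)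
qed

text \<open>The iterated directional derivative along \<open>- u\<close>, as a sum over lists rather than multi-indices:
  no symmetry of the derivatives and no multinomial coefficients are needed.\<close>

definition dir_deriv :: "nat \<Rightarrow> (real^'d::finite \<Rightarrow> real) \<Rightarrow> real^'d \<Rightarrow> real^'d \<Rightarrow> real" where
  "dir_deriv k \<phi> u x = (- 1) ^ k * (\<Sum>is | length is = k. mono_list is u * iter_partial is \<phi> x)"

lemma has_derivative_dir_deriv:
  fixes \<phi> :: "real^'d::finite \<Rightarrow> real"
  assumes "test_function \<phi>"
  shows "((\<lambda>t. dir_deriv k \<phi> u (x - t *\<^sub>R u)) has_real_derivative dir_deriv (Suc k) \<phi> u (x - t *\<^sub>R u)) (at t)"
proof -
  have "((\<lambda>t. dir_deriv k \<phi> u (x - t *\<^sub>R u)) has_real_derivative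
      (- 1) ^ k * (\<Sum>is | length is = k. mono_list is u * - (\<Sum>i\<in>UNIV. u $ i * iter_partial (i # is) \<phi> (x - t *\<^sub>R u)))) (at t)"
    unfolding dir_deriv_def
    by (intro DERIV_cmult DERIV_sum test_function_line_derivative[OF assms])
  also have "(- 1) ^ k * (\<Sum>is | length is = k. mono_list is u * - (\<Sum>i\<in>UNIV. u $ i * iter_partial (i # is) \<phi> (x - t *\<^sub>R u)))
      = dir_deriv (Suc k) \<phi> u (x - t *\<^sub>R u)"
    unfolding dir_deriv_def sum_lists_length_Suc
    by (simp add: sum_distrib_left sum_negf mult_ac)
  finally show ?thesis .
qed

text \<open>The weight in the integral remainder of order s on [0, h], extended by 0 to the line. As
  an integrable function for \<open>lborel\<close> it can be combined with \<open>K\<close> into one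
  weight on a product space.\<close>

definition taylor_weight :: "nat \<Rightarrow> real \<Rightarrow> real \<Rightarrow> real" where
  "taylor_weight s h t = indicator {0..h} t * ((h - t) ^ (s - 1) / fact (s - 1))"

lemma measurable_taylor_weight [measurable]: "taylor_weight s h \<in> borel_measurable borel"
  unfolding taylor_weight_def by measurable

lemma taylor_weight_nonneg: "0 \<le> taylor_weight s h t"
  by (auto simp: taylor_weight_def indicator_def)

lemma taylor_weight_le: "taylor_weight s h t \<le> indicator {0..h} t * h ^ (s - 1)"
proof (cases "t \<in> {0..h}")
  case True
  have "(h - t) ^ (s - 1) / fact (s - 1) \<le> (h - t) ^ (s - 1) / 1"
    using True by (intro divide_left_mono) (auto simp: fact_ge_1)
  also have "\<dots> \<le> h ^ (s - 1)"
    using True by (simp add: power_mono)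
  finally show ?thesis using True by (simp add: taylor_weight_def)
qed (simp add: taylor_weight_def)

lemma integrable_taylor_weight: "0 < h \<Longrightarrow> integrable lborel (taylor_weight s h)"
  and integral_taylor_weight_le: "0 < h \<Longrightarrow> 1 \<le> s \<Longrightarrow> (\<integral>t. \<bar>taylor_weight s h t\<bar> \<partial>lborel) \<le> h ^ s"
proof -
  assume h: "0 < h"
  have i: "integrable lborel (\<lambda>t. indicator {0..h} t * h ^ (s - 1))"
    by (intro integrable_mult_left) (use h in auto)
  show j: "integrable lborel (taylor_weight s h)"
    by (rule Bochner_Integration.integrable_bound[OF i])
       (auto simp: taylor_weight_nonneg simp del: One_nat_def
         intro!: order_trans[OF taylor_weight_le])
  assume s: "1 \<le> s"
  have "(\<integral>t. \<bar>taylor_weight s h t\<bar> \<partial>lborel) \<le> (\<integral>t. indicator {0..h} t * h ^ (s - 1) \<partial>lborel)"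
    by (intro integral_mono integrable_abs i j) (simp add: taylor_weight_nonneg taylor_weight_le del: One_nat_def)
  also have "\<dots> = h * h ^ (s - 1)" using h by simp
  also have "\<dots> = h ^ s" using s by (cases s) auto
  finally show "(\<integral>t. \<bar>taylor_weight s h t\<bar> \<partial>lborel) \<le> h ^ s" .
qed

text \<open>The one-variable formula on [0, h] for the function sending t to \<phi> (x - t u), whose
  k-th derivative is \<open>dir_deriv k \<phi> u\<close> along the line by
  \<open>has_derivative_dir_deriv\<close>.\<close>

lemma test_function_taylor:
  fixes \<phi> :: "real^'d::finite \<Rightarrow> real"
  assumes \<phi>: "test_function \<phi>" and s: "1 \<le> s" and h: "0 < h"
  shows "\<phi> (x - h *\<^sub>R u) = (\<Sum>k<s. h ^ k / fact k * dir_deriv k \<phi> u x)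
     + (\<integral>t. taylor_weight s h t * dir_deriv s \<phi> u (x - t *\<^sub>R u) \<partial>lborel)"
proof -
  define D where "D k t = dir_deriv k \<phi> u (x - t *\<^sub>R u)" for k t
  define g where "g t = ((h - t) ^ (s - 1) / fact (s - 1)) *\<^sub>R D s t" for t
  have D0: "D 0 t = \<phi> (x - t *\<^sub>R u)" for t by (simp add: D_def dir_deriv_def)
  have deriv: "(D k has_real_derivative D (Suc k) t) (at t)" for k t
    unfolding D_def by (rule has_derivative_dir_deriv[OF \<phi>])
  have D': "(D m has_vector_derivative D (Suc m) t) (at t within {0..h})" for m t
    using deriv by (simp add: has_real_derivative_iff_has_vector_derivative[symmetric] has_field_derivative_at_within)
  have "D 0 h = (\<Sum>i<s. ((h - 0) ^ i / fact i) *\<^sub>R D i 0) + integral {0..h} g"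
    unfolding g_def 
    by (rule Taylor_integral[where p = s and Df = D and f = "D 0" and a = 0 and b = h, OF _ refl D'])
       (use s h in auto)
  moreover have "continuous_on {0..h} (D s)"
    using deriv[of s] by (intro continuous_at_imp_continuous_on ballI DERIV_isCont) auto
  then have "continuous_on {0..h} g"
    unfolding g_def by (intro continuous_intros) auto
  then have "set_integrable lborel {0..h} g" by (rule borel_integrable_atLeastAtMost')
  then have "integral {0..h} g = (LINT t : {0..h} | lborel. g t)"
    by (rule set_borel_integral_eq_integral(2)[symmetric])
  moreover have "\<dots> = (\<integral>t. taylor_weight s h t * D s t \<partial>lborel)"
    by (simp add: set_lebesgue_integral_def g_def taylor_weight_def mult.assoc)
  ultimately have "D 0 h = (\<Sum>i<s. (h ^ i / fact i) * D i 0) + (\<integral>t. taylor_weight s h t * D s t \<partial>lborel)"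
    by (simp only: real_scaleR_def diff_zero)
  then show ?thesis
    unfolding D_def by (simp only: scaleR_zero_left diff_zero) (simp add: dir_deriv_def)
qed

lemma integrable_mult_bounded:
  fixes f g :: "'a \<Rightarrow> real"
  assumes f: "integrable M f" and g: "g \<in> borel_measurable M" and bound: "\<And>x. \<bar>g x\<bar> \<le> B"
  shows "integrable M (\<lambda>x. f x * g x)"
proof (rule Bochner_Integration.integrable_bound)
  show "integrable M (\<lambda>x. B * f x)" using f by simp
  have "\<bar>g x\<bar> * \<bar>f x\<bar> \<le> \<bar>B\<bar> * \<bar>f x\<bar>" for x
    using bound[of x] by (intro mult_right_mono) auto
  then show "AE x in M. norm (f x * g x) \<le> norm (B * f x)"
    by (simp add: abs_mult mult.commute)
qed (use f g in measurable)

lemma (in pair_sigma_finite) integrable_pair_mult_bounded: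
  fixes f w :: "_ \<Rightarrow> real"
  assumes f: "integrable M1 f" and w: "integrable M2 w"
    and \<psi>[measurable]: "case_prod \<psi> \<in> borel_measurable (M1 \<Otimes>\<^sub>M M2)"
    and bound: "\<And>x t. \<bar>\<psi> x t\<bar> \<le> B"
  shows "integrable (M1 \<Otimes>\<^sub>M M2) (\<lambda>(x, t). f x * w t * \<psi> x t)"
proof -
  have [measurable]: "f \<in> borel_measurable M1" "w \<in> borel_measurable M2" using f w by auto
  have "integrable (M1 \<Otimes>\<^sub>M M2) (\<lambda>z. f (fst z) * w (snd z))"
  proof (rule Fubini_integrable)
    have "integrable M1 (\<lambda>x. \<bar>f x\<bar> * (\<integral>y. \<bar>w y\<bar> \<partial>M2))" using f by simp
    then show "integrable M1 (\<lambda>x. \<integral>y. norm (f (fst (x, y)) * w (snd (x, y))) \<partial>M2)"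
      by (simp add: abs_mult)
    show "AE x in M1. integrable M2 (\<lambda>y. f (fst (x, y)) * w (snd (x, y)))"
      using w by simp
  qed measurable
  from integrable_mult_bounded[OF this \<psi>, of B] bound show ?thesis
    by (simp add: split_beta')
qed

lemma dir_deriv_measurable:
  "test_function \<phi> \<Longrightarrow> dir_deriv k \<phi> u \<in> borel_measurable borel"
  unfolding dir_deriv_def [abs_def]
  using test_function_measurable[of \<phi>] by (auto intro!: borel_measurable_sum borel_measurable_times)

lemma dir_deriv_bounded:
  fixes \<phi> :: "real^'d::finite \<Rightarrow> real"
  assumes "test_function \<phi>"
  obtains B where "\<And>x. \<bar>dir_deriv k \<phi> u x\<bar> \<le> B"
proof -
  have "\<forall>is. \<exists>B. \<forall>x. \<bar>iter_partial is \<phi> x\<bar> \<le> B"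
    using test_function_bounded[OF assms] by metis
  then obtain B where B: "\<And>is x. \<bar>iter_partial is \<phi> x\<bar> \<le> B is" by metis
  have "\<bar>dir_deriv k \<phi> u x\<bar> \<le> (\<Sum>is | length is = k. \<bar>mono_list is u\<bar> * B is)" for x
    unfolding dir_deriv_def abs_mult power_abs
    by (simp add: abs_mult) (intro order_trans[OF sum_abs] sum_mono, simp add: abs_mult mult_left_mono B)
  then show thesis by (rule that)
qed

text \<open>The definition of weak derivatives admits every list with the prescribed counts, so the
  identity holds for the given list itself and no derivatives have to be exchanged.\<close>

lemma weak_deriv_translate:
  fixes f :: "real^'d::finite \<Rightarrow> real"
  assumes "has_weak_deriv (count_list is) f g" and \<phi>: "test_function \<phi>"
  shows "(\<integral>x. f x * iter_partial is \<phi> (x - v) \<partial>lborel)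
    = (- 1) ^ length is * (\<integral>x. g x * \<phi> (x - v) \<partial>lborel)"
  using assms(1) test_function_translate[OF \<phi>, of v]
  unfolding has_weak_deriv_def iter_partial_translate[OF \<phi>, symmetric, THEN fun_cong] mi_order_count_list
  by blast

text \<open>Derivatives move onto \<open>f\<close> only in the remainder. In the terms of order k <
  s they stay on the test function: these terms depend on u only through monomials of degree k, on
  which the moment conditions of the kernel act.\<close>

lemma integral_translate_taylor:
  fixes f :: "real^'d::finite \<Rightarrow> real"
  assumes \<phi>: "test_function \<phi>" and s: "1 \<le> s" and h: "0 < h" and p: "1 \<le> p"
    and f: "integrable lborel f"
    and G: "\<And>is. length is = s \<Longrightarrow> has_weak_deriv (count_list is) f (G is)"
    and GLp: "\<And>is. length is = s \<Longrightarrow> in_Lp p (G is)"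
  shows "(\<integral>x. f x * \<phi> (x - h *\<^sub>R u) \<partial>lborel)
    = (\<Sum>k<s. h ^ k / fact k * ((- 1) ^ k * (\<Sum>is | length is = k. mono_list is u * (\<integral>x. f x * iter_partial is \<phi> x \<partial>lborel))))
      + (\<Sum>is | length is = s. mono_list is u * (\<integral>t. taylor_weight s h t * (\<integral>x. G is x * \<phi> (x - t *\<^sub>R u) \<partial>lborel) \<partial>lborel))"
proof -
  let ?w = "taylor_weight s h"
  have [measurable]: "f \<in> borel_measurable borel" using f by auto
  note m[measurable] = test_function_measurable[OF \<phi>] dir_deriv_measurable[OF \<phi>]
  have m0[measurable]: "\<phi> \<in> borel_measurable borel" using m(1)[of "[]"] by simp
  have int: "integrable lborel (\<lambda>x. f x * iter_partial is \<phi> (x - v))" for "is" v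
  proof -
    obtain B where "\<And>x. \<bar>iter_partial is \<phi> x\<bar> \<le> B" using test_function_bounded[OF \<phi>] by blast
    then show ?thesis by (intro integrable_mult_bounded[OF f, of _ B]) auto
  qed
  obtain B where "\<And>x. \<bar>dir_deriv s \<phi> u x\<bar> \<le> B" using dir_deriv_bounded[OF \<phi>] by blast
  then have J: "integrable (lborel \<Otimes>\<^sub>M lborel) (\<lambda>(x, t). f x * ?w t * dir_deriv s \<phi> u (x - t *\<^sub>R u))"
    by (intro lborel_pair.integrable_pair_mult_bounded[OF f integrable_taylor_weight[OF h], of _ B]) auto
  have "(\<integral>x. f x * \<phi> (x - h *\<^sub>R u) \<partial>lborel)
      = (\<integral>x. (\<Sum>k<s. h ^ k / fact k * ((- 1) ^ k * (\<Sum>is | length is = k. mono_list is u * (f x * iter_partial is \<phi> x))))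
        + (\<integral>t. f x * ?w t * dir_deriv s \<phi> u (x - t *\<^sub>R u) \<partial>lborel) \<partial>lborel)"
  proof (intro Bochner_Integration.integral_cong refl)
    fix x
    have "f x * (\<Sum>k<s. h ^ k / fact k * dir_deriv k \<phi> u x)
        = (\<Sum>k<s. h ^ k / fact k * ((- 1) ^ k * (\<Sum>is | length is = k. mono_list is u * (f x * iter_partial is \<phi> x))))"
      unfolding dir_deriv_def by (simp add: sum_distrib_left mult_ac)
    moreover have "f x * (\<integral>t. ?w t * dir_deriv s \<phi> u (x - t *\<^sub>R u) \<partial>lborel)
        = (\<integral>t. f x * ?w t * dir_deriv s \<phi> u (x - t *\<^sub>R u) \<partial>lborel)"
      by (simp add: mult.assoc)
    ultimately show "f x * \<phi> (x - h *\<^sub>R u)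
      = (\<Sum>k<s. h ^ k / fact k * ((- 1) ^ k * (\<Sum>is | length is = k. mono_list is u * (f x * iter_partial is \<phi> x))))
        + (\<integral>t. f x * ?w t * dir_deriv s \<phi> u (x - t *\<^sub>R u) \<partial>lborel)"
      unfolding test_function_taylor[OF \<phi> s h] distrib_left by (simp only:)
  qed
  also have "\<dots> = (\<integral>x. (\<Sum>k<s. h ^ k / fact k * ((- 1) ^ k * (\<Sum>is | length is = k. mono_list is u * (f x * iter_partial is \<phi> x)))) \<partial>lborel)
        + (\<integral>x. (\<integral>t. f x * ?w t * dir_deriv s \<phi> u (x - t *\<^sub>R u) \<partial>lborel) \<partial>lborel)"
    using int[of _ 0] lborel_pair.integrable_fst[OF J]
    by (intro Bochner_Integration.integral_add Bochner_Integration.integrable_sum integrable_mult_right) auto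
  also have "(\<integral>x. (\<Sum>k<s. h ^ k / fact k * ((- 1) ^ k * (\<Sum>is | length is = k. mono_list is u * (f x * iter_partial is \<phi> x)))) \<partial>lborel)
      = (\<Sum>k<s. h ^ k / fact k * ((- 1) ^ k * (\<Sum>is | length is = k. mono_list is u * (\<integral>x. f x * iter_partial is \<phi> x \<partial>lborel))))"
    using int[of _ 0] by (subst Bochner_Integration.integral_sum) auto
  also have "(\<integral>x. (\<integral>t. f x * ?w t * dir_deriv s \<phi> u (x - t *\<^sub>R u) \<partial>lborel) \<partial>lborel)
      = (\<integral>t. (\<integral>x. f x * ?w t * dir_deriv s \<phi> u (x - t *\<^sub>R u) \<partial>lborel) \<partial>lborel)"
    by (rule lborel_pair.Fubini_integral[OF J, symmetric])
  also have "\<dots> = (\<integral>t. (\<Sum>is | length is = s. mono_list is u * (?w t * (\<integral>x. G is x * \<phi> (x - t *\<^sub>R u) \<partial>lborel))) \<partial>lborel)"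
  proof (intro Bochner_Integration.integral_cong refl)
    fix t
    have "(\<integral>x. f x * ?w t * dir_deriv s \<phi> u (x - t *\<^sub>R u) \<partial>lborel)
        = (\<integral>x. (\<Sum>is | length is = s. (?w t * (- 1) ^ s * mono_list is u) * (f x * iter_partial is \<phi> (x - t *\<^sub>R u))) \<partial>lborel)"
      unfolding dir_deriv_def by (simp add: sum_distrib_left mult_ac)
    also have "\<dots> = (\<Sum>is | length is = s. (?w t * (- 1) ^ s * mono_list is u) * (\<integral>x. f x * iter_partial is \<phi> (x - t *\<^sub>R u) \<partial>lborel))"
      using int by (subst Bochner_Integration.integral_sum) auto
    also have "\<dots> = (\<Sum>is | length is = s. mono_list is u * (?w t * (\<integral>x. G is x * \<phi> (x - t *\<^sub>R u) \<partial>lborel)))"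
    proof (intro sum.cong refl)
      fix "is" :: "'d list" assume "is \<in> {is. length is = s}"
      then have l: "length is = s" by simp
      \<comment> \<open>One sign comes from the direction -u in \<open>dir_deriv\<close>, the other
        from the definition of the weak derivative.\<close>
      have "(- 1) ^ s * (- 1) ^ s = (1 :: real)" by (simp flip: power_mult_distrib)
      then have "?w t * (- 1) ^ s * mono_list is u * ((- 1) ^ s * X) = mono_list is u * (?w t * X)" for X
        by (simp add: mult_ac)
      then show "(?w t * (- 1) ^ s * mono_list is u) * (\<integral>x. f x * iter_partial is \<phi> (x - t *\<^sub>R u) \<partial>lborel)
          = mono_list is u * (?w t * (\<integral>x. G is x * \<phi> (x - t *\<^sub>R u) \<partial>lborel))"
        by (simp only: weak_deriv_translate[OF G[OF l] \<phi>] l)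
    qed
    finally show "(\<integral>x. f x * ?w t * dir_deriv s \<phi> u (x - t *\<^sub>R u) \<partial>lborel)
      = (\<Sum>is | length is = s. mono_list is u * (?w t * (\<integral>x. G is x * \<phi> (x - t *\<^sub>R u) \<partial>lborel)))" .
  qed
  also have "\<dots> = (\<Sum>is | length is = s. mono_list is u * (\<integral>t. ?w t * (\<integral>x. G is x * \<phi> (x - t *\<^sub>R u) \<partial>lborel) \<partial>lborel))"
  proof -
    obtain B where B: "\<And>x. \<bar>\<phi> x\<bar> \<le> B" using test_function_bounded[OF \<phi>, of "[]"] by auto
    have "integrable lborel (\<lambda>t. ?w t * (\<integral>x. G is x * \<phi> (x - t *\<^sub>R u) \<partial>lborel))" if "length is = s" for "is"
      using test_function_integrable[OF \<phi>, of "[]"]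
      by (intro integrable_mult_shift_integral[OF sigma_finite_lborel integrable_taylor_weight[OF h] GLp[OF that] _ p _ B]) auto
    then show ?thesis by (subst Bochner_Integration.integral_sum) auto
  qed
  finally show ?thesis .
qed

text \<open>\<open>integrable_shift_average_mult\<close> asks only for a bounded integrable factor,
  so the indicator of a compact set can take the place of the test function.\<close>

lemma locally_integrable_shift_average:
  fixes k :: "'b \<Rightarrow> real" and G :: "'a::euclidean_space \<Rightarrow> real"
  assumes M: "sigma_finite_measure M" and k: "integrable M k" and G: "in_Lp p G"
    and \<tau>[measurable]: "\<tau> \<in> borel_measurable M" and p: "1 \<le> p"
  shows "locally_integrable (\<lambda>x. \<integral>u. k u * G (x + \<tau> u) \<partial>M)"
  unfolding locally_integrable_def
proof (intro conjI allI impI)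
  interpret M: sigma_finite_measure M by fact
  have [measurable]: "k \<in> borel_measurable M" using k by auto
  have [measurable]: "G \<in> borel_measurable borel" using G by (simp add: in_Lp_def)
  show "(\<lambda>x. \<integral>u. k u * G (x + \<tau> u) \<partial>M) \<in> borel_measurable borel"
    by measurable
  fix C :: "'a set" assume C: "compact C"
  then have [measurable]: "C \<in> sets borel" by (simp add: compact_imp_closed)
  have "integrable lborel (\<lambda>x. (\<integral>u. k u * G (x + \<tau> u) \<partial>M) * indicator C x)"
  proof (rule integrable_shift_average_mult[OF M k G \<tau> p])
    show "integrable lborel (indicator C :: 'a \<Rightarrow> real)"
      using emeasure_bounded_finite[OF compact_imp_bounded[OF C]]
      by (intro integrable_real_indicator) auto
    show "\<bar>indicator C x\<bar> \<le> (1::real)" for x by (simp add: indicator_def)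
  qed measurable
  then show "set_integrable lborel C (\<lambda>x. \<integral>u. k u * G (x + \<tau> u) \<partial>M)"
    by (simp add: set_integrable_def mult.commute)
qed

lemma locally_integrable_add:
  "locally_integrable f \<Longrightarrow> locally_integrable g \<Longrightarrow> locally_integrable (\<lambda>x. f x + g x)"
  unfolding locally_integrable_def by (auto intro: set_integral_add)

lemma locally_integrable_diff:
  "locally_integrable f \<Longrightarrow> locally_integrable g \<Longrightarrow> locally_integrable (\<lambda>x. f x - g x)"
  unfolding locally_integrable_def by (auto intro: set_integral_diff)

lemma locally_integrable_sum:
  "finite I \<Longrightarrow> (\<And>i. i \<in> I \<Longrightarrow> locally_integrable (f i)) \<Longrightarrow> locally_integrable (\<lambda>x. \<Sum>i\<in>I. f i x)"
proof (induction I rule: finite_induct)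
  case empty
  then show ?case by (simp add: locally_integrable_def set_integrable_def)
qed (auto intro: locally_integrable_add)

lemma integrable_imp_locally_integrable:
  "integrable lborel f \<Longrightarrow> locally_integrable f"
  unfolding locally_integrable_def set_integrable_def
  by (auto intro!: integrable_mult_indicator simp del: real_scaleR_def dest: compact_imp_closed)

lemma integrable_imp_in_L1: "integrable lborel f \<Longrightarrow> in_Lp 1 f"
  unfolding in_Lp_def Lp_norm_pow_def by (auto simp: integrable_iff_bounded)

section \<open>Kernel moments and the representation of the bias\<close>

lemma kernel_moment:
  assumes K: "K \<in> kernels s" and l: "length is < s"
  shows "integrable lborel (\<lambda>u. K u * mono_list is u)"
    and "(\<integral>u. K u * mono_list is u \<partial>lborel) = (if is = [] then 1 else 0)"
proof -
  have "has_bochner_integral lborel (\<lambda>u. K u * mono_list is u) (if is = [] then 1 else 0)"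
  proof (cases "is = []")
    case True
    then show ?thesis using K by (simp add: kernels_def)
  next
    case False
    then have "1 \<le> mi_order (count_list is)" "mi_order (count_list is) < s"
      using l by (auto simp: mi_order_count_list Suc_le_eq)
    then have "has_bochner_integral lborel (\<lambda>u. mi_monom (count_list is) u * K u) 0"
      using K unfolding kernels_def by blast
    then show ?thesis using False by (simp add: mi_monom_count_list mult.commute)
  qed
  then show "integrable lborel (\<lambda>u. K u * mono_list is u)"
    "(\<integral>u. K u * mono_list is u \<partial>lborel) = (if is = [] then 1 else 0)"
    by (auto simp: has_bochner_integral_iff)
qed

lemma kernel_integrable_mono:
  assumes K: "K \<in> kernels s" and l: "length is = s"
  shows "integrable lborel (\<lambda>u. K u * mono_list is u)"
proof -
  have [measurable]: "K \<in> borel_measurable borel" using K by (simp add: kernels_def)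
  have "integrable lborel (\<lambda>u. \<bar>mi_monom (count_list is) u\<bar> * \<bar>K u\<bar>)"
    using K l mi_order_count_list[of "is"] unfolding kernels_def by blast
  then have "integrable lborel (\<lambda>u. \<bar>K u * mono_list is u\<bar>)"
    by (simp add: mi_monom_count_list abs_mult mult.commute)
  then show ?thesis by (subst (asm) integrable_abs_iff) auto
qed

text \<open>The weight of the shift by t u in the representation of the bias. Treating (u, t) as one
  variable makes the remainder a single average of shifts, to which Young's inequality applies
  directly.\<close>

definition taylor_kernel ::
    "nat \<Rightarrow> real \<Rightarrow> (real^'d::finite \<Rightarrow> real) \<Rightarrow> 'd list \<Rightarrow> (real^'d) \<times> real \<Rightarrow> real" where
  "taylor_kernel s h K is = (\<lambda>z. K (fst z) * mono_list is (fst z) * taylor_weight s h (snd z))"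

lemma integrable_taylor_kernel:
  assumes K: "K \<in> kernels s" and l: "length is = s" and h: "0 < h"
  shows "integrable (lborel \<Otimes>\<^sub>M lborel) (taylor_kernel s h K is)"
  using lborel_pair.integrable_pair_mult_bounded[OF kernel_integrable_mono[OF K l] integrable_taylor_weight[OF h], of "\<lambda>_ _. 1" 1]
  by (simp add: taylor_kernel_def split_beta')

lemma integral_abs_taylor_kernel_le:
  assumes K: "K \<in> kernels s" and l: "length is = s" and h: "0 < h" and s: "1 \<le> s"
  shows "(\<integral>z. \<bar>taylor_kernel s h K is z\<bar> \<partial>(lborel \<Otimes>\<^sub>M lborel)) \<le> (\<integral>u. \<bar>K u * mono_list is u\<bar> \<partial>lborel) * h ^ s"
proof -
  have "(\<integral>z. \<bar>taylor_kernel s h K is z\<bar> \<partial>(lborel \<Otimes>\<^sub>M lborel))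
      = (\<integral>u. (\<integral>t. \<bar>taylor_kernel s h K is (u, t)\<bar> \<partial>lborel) \<partial>lborel)"
    by (rule lborel_pair.integral_fst'[symmetric]) (intro integrable_abs integrable_taylor_kernel[OF K l h])
  also have "\<dots> = (\<integral>u. \<bar>K u * mono_list is u\<bar> * (\<integral>t. \<bar>taylor_weight s h t\<bar> \<partial>lborel) \<partial>lborel)"
    by (simp add: taylor_kernel_def abs_mult)
  also have "\<dots> = (\<integral>u. \<bar>K u * mono_list is u\<bar> \<partial>lborel) * (\<integral>t. \<bar>taylor_weight s h t\<bar> \<partial>lborel)"
    by simp
  also have "\<dots> \<le> (\<integral>u. \<bar>K u * mono_list is u\<bar> \<partial>lborel) * h ^ s"
    by (intro mult_left_mono integral_taylor_weight_le h s) simp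
  finally show ?thesis .
qed

text \<open>Both sides are locally integrable, so pairings with test functions determine them almost
  everywhere. \<open>integral_shift_average_mult\<close> is used in both directions: with
  \<open>K\<close> and the shift h u to reach Taylor's formula for the test function, with
  \<open>taylor_kernel\<close> and the shift t u to come back. \<open>f\<close> enters as an L^1
  function, its weak derivatives as L^p functions.\<close>

lemma kernel_bias_representation:
  fixes f K :: "real^'d::finite \<Rightarrow> real"
  assumes K: "K \<in> kernels s" and s: "1 \<le> s" and h: "0 < h" and p: "1 \<le> p"
    and f: "integrable lborel f"
    and G: "\<And>is. length is = s \<Longrightarrow> has_weak_deriv (count_list is) f (G is)"
    and GLp: "\<And>is. length is = s \<Longrightarrow> in_Lp p (G is)"
  shows "AE x in lborel. (\<integral>u. K u * f (x + h *\<^sub>R u) \<partial>lborel) - f x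
    = (\<Sum>is | length is = s. \<integral>z. taylor_kernel s h K is z * G is (x + snd z *\<^sub>R fst z) \<partial>(lborel \<Otimes>\<^sub>M lborel))"
proof -
  let ?M = "lborel \<Otimes>\<^sub>M lborel :: ((real^'d) \<times> real) measure"
  have M: "sigma_finite_measure ?M"
    by (simp add: lborel_prod sigma_finite_lborel)
  have \<tau>: "(\<lambda>z. snd z *\<^sub>R fst z) \<in> borel_measurable ?M" by measurable
  have iK: "integrable lborel K" using K by (auto simp: kernels_def has_bochner_integral_iff)
  define b where "b x = (\<integral>u. K u * f (x + h *\<^sub>R u) \<partial>lborel)" for x
  define g where "g is x = (\<integral>z. taylor_kernel s h K is z * G is (x + snd z *\<^sub>R fst z) \<partial>?M)" for "is" x
  have "locally_integrable b"
    unfolding b_def by (rule locally_integrable_shift_average[OF sigma_finite_lborel iK integrable_imp_in_L1[OF f]]) auto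
  moreover have "locally_integrable (g is)" if "length is = s" for "is"
    unfolding g_def by (rule locally_integrable_shift_average[OF M integrable_taylor_kernel[OF K that h] GLp[OF that] \<tau> p])
  ultimately have li: "locally_integrable (\<lambda>x. (b x - f x) - (\<Sum>is | length is = s. g is x))"
    using integrable_imp_locally_integrable[OF f]
    by (intro locally_integrable_diff locally_integrable_sum finite_lists_length) auto
  have "AE x in lborel. (b x - f x) - (\<Sum>is | length is = s. g is x) = 0"
  proof (rule fundamental_lemma_calculus_of_variations[OF li])
    fix \<phi> :: "real^'d \<Rightarrow> real" assume \<phi>: "test_function \<phi>"
    have [measurable]: "\<phi> \<in> borel_measurable borel" using test_function_measurable[OF \<phi>, of "[]"] by simp
    have i\<phi>: "integrable lborel \<phi>" using test_function_integrable[OF \<phi>, of "[]"] by simp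
    obtain B where B: "\<And>x. \<bar>\<phi> x\<bar> \<le> B" using test_function_bounded[OF \<phi>, of "[]"] by auto
    have ib: "integrable lborel (\<lambda>x. b x * \<phi> x)"
      unfolding b_def
      by (rule integrable_shift_average_mult[OF sigma_finite_lborel iK integrable_imp_in_L1[OF f] _ _ i\<phi> B]) auto
    have if': "integrable lborel (\<lambda>x. f x * \<phi> x)"
      by (rule integrable_mult_bounded[OF f _ B]) measurable
    have ig: "integrable lborel (\<lambda>x. g is x * \<phi> x)" if "length is = s" for "is"
      unfolding g_def
      by (rule integrable_shift_average_mult[OF M integrable_taylor_kernel[OF K that h] GLp[OF that] \<tau> p i\<phi> B]) measurable
    \<comment> \<open>The pairing with \<open>G\<close> depends on (u, t) only through v = t u.
      \<open>P\<close> collects the pairings in which the derivatives stay on the test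
      function.\<close>
    define \<Psi> where "\<Psi> is v = (\<integral>x. G is x * \<phi> (x - v) \<partial>lborel)" for "is" v
    define P where "P is = (\<integral>x. f x * iter_partial is \<phi> x \<partial>lborel)" for "is"
    have iT: "integrable ?M (\<lambda>z. taylor_kernel s h K is z * \<Psi> is (snd z *\<^sub>R fst z))" if "length is = s" for "is"
      unfolding \<Psi>_def
      by (rule integrable_mult_shift_integral[OF M integrable_taylor_kernel[OF K that h] GLp[OF that] \<tau> p i\<phi> B]) measurable
    have T: "(\<integral>t. taylor_kernel s h K is (u, t) * \<Psi> is (snd (u, t) *\<^sub>R fst (u, t)) \<partial>lborel)
        = K u * mono_list is u * (\<integral>t. taylor_weight s h t * \<Psi> is (t *\<^sub>R u) \<partial>lborel)" for "is" u
      by (simp add: taylor_kernel_def mult.assoc)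
    have iT': "integrable lborel (\<lambda>u. K u * mono_list is u * (\<integral>t. taylor_weight s h t * \<Psi> is (t *\<^sub>R u) \<partial>lborel))"
      if "length is = s" for "is"
      using lborel_pair.integrable_fst'[OF iT[OF that]] unfolding T .
    have eT: "(\<integral>u. K u * mono_list is u * (\<integral>t. taylor_weight s h t * \<Psi> is (t *\<^sub>R u) \<partial>lborel) \<partial>lborel)
        = (\<integral>x. g is x * \<phi> x \<partial>lborel)" if "length is = s" for "is"
    proof -
      have "(\<integral>x. g is x * \<phi> x \<partial>lborel) = (\<integral>z. taylor_kernel s h K is z * \<Psi> is (snd z *\<^sub>R fst z) \<partial>?M)"
        unfolding g_def \<Psi>_def
        by (rule integral_shift_average_mult[OF M integrable_taylor_kernel[OF K that h] GLp[OF that] \<tau> p i\<phi> B]) measurable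
      also have "\<dots> = (\<integral>u. (\<integral>t. taylor_kernel s h K is (u, t) * \<Psi> is (snd (u, t) *\<^sub>R fst (u, t)) \<partial>lborel) \<partial>lborel)"
        by (rule lborel_pair.integral_fst'[OF iT[OF that], symmetric])
      finally show ?thesis unfolding T by simp
    qed
    have "(\<integral>x. b x * \<phi> x \<partial>lborel) = (\<integral>u. K u * (\<integral>x. f x * \<phi> (x - h *\<^sub>R u) \<partial>lborel) \<partial>lborel)"
      unfolding b_def
      by (rule integral_shift_average_mult[OF sigma_finite_lborel iK integrable_imp_in_L1[OF f] _ _ i\<phi> B]) auto
    also have "\<dots> = (\<integral>u. (\<Sum>k<s. \<Sum>is | length is = k. (h ^ k / fact k * (- 1) ^ k * P is) * (K u * mono_list is u))
        + (\<Sum>is | length is = s. K u * mono_list is u * (\<integral>t. taylor_weight s h t * \<Psi> is (t *\<^sub>R u) \<partial>lborel)) \<partial>lborel)"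
    proof (rule Bochner_Integration.integral_cong[OF refl])
      fix u
      have "K u * (\<Sum>k<s. h ^ k / fact k * ((- 1) ^ k * (\<Sum>is | length is = k. mono_list is u * P is)))
          = (\<Sum>k<s. \<Sum>is | length is = k. (h ^ k / fact k * (- 1) ^ k * P is) * (K u * mono_list is u))"
        by (simp add: sum_distrib_left mult_ac)
      moreover have "K u * (\<Sum>is | length is = s. mono_list is u * (\<integral>t. taylor_weight s h t * \<Psi> is (t *\<^sub>R u) \<partial>lborel))
          = (\<Sum>is | length is = s. K u * mono_list is u * (\<integral>t. taylor_weight s h t * \<Psi> is (t *\<^sub>R u) \<partial>lborel))"
        by (simp add: sum_distrib_left mult.assoc)
      moreover have "(\<integral>x. f x * \<phi> (x - h *\<^sub>R u) \<partial>lborel)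
          = (\<Sum>k<s. h ^ k / fact k * ((- 1) ^ k * (\<Sum>is | length is = k. mono_list is u * P is)))
            + (\<Sum>is | length is = s. mono_list is u * (\<integral>t. taylor_weight s h t * \<Psi> is (t *\<^sub>R u) \<partial>lborel))"
        unfolding P_def \<Psi>_def by (rule integral_translate_taylor[OF \<phi> s h p f G GLp])
      ultimately show "K u * (\<integral>x. f x * \<phi> (x - h *\<^sub>R u) \<partial>lborel)
        = (\<Sum>k<s. \<Sum>is | length is = k. (h ^ k / fact k * (- 1) ^ k * P is) * (K u * mono_list is u))
          + (\<Sum>is | length is = s. K u * mono_list is u * (\<integral>t. taylor_weight s h t * \<Psi> is (t *\<^sub>R u) \<partial>lborel))"
        by (simp only: distrib_left)
    qed
    also have "\<dots> = (\<Sum>k<s. \<Sum>is | length is = k. (h ^ k / fact k * (- 1) ^ k * P is) * (\<integral>u. K u * mono_list is u \<partial>lborel))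
        + (\<Sum>is | length is = s. \<integral>u. K u * mono_list is u * (\<integral>t. taylor_weight s h t * \<Psi> is (t *\<^sub>R u) \<partial>lborel) \<partial>lborel)"
    proof -
      have i1: "integrable lborel (\<lambda>u. (h ^ k / fact k * (- 1) ^ k * P is) * (K u * mono_list is u))"
        if "k < s" "length is = k" for k "is"
        using kernel_moment(1)[OF K, of "is"] that by (intro integrable_mult_right) auto
      have "(\<integral>u. (\<Sum>k<s. \<Sum>is | length is = k. (h ^ k / fact k * (- 1) ^ k * P is) * (K u * mono_list is u)) \<partial>lborel)
        = (\<Sum>k<s. \<Sum>is | length is = k. (h ^ k / fact k * (- 1) ^ k * P is) * (\<integral>u. K u * mono_list is u \<partial>lborel))"
      proof -
        have "(\<integral>u. (\<Sum>k<s. \<Sum>is | length is = k. (h ^ k / fact k * (- 1) ^ k * P is) * (K u * mono_list is u)) \<partial>lborel)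
          = (\<Sum>k<s. (\<integral>u. (\<Sum>is | length is = k. (h ^ k / fact k * (- 1) ^ k * P is) * (K u * mono_list is u)) \<partial>lborel))"
          using i1 by (intro Bochner_Integration.integral_sum Bochner_Integration.integrable_sum) auto
        also have "\<dots> = (\<Sum>k<s. \<Sum>is | length is = k. \<integral>u. (h ^ k / fact k * (- 1) ^ k * P is) * (K u * mono_list is u) \<partial>lborel)"
          using i1 by (intro sum.cong refl Bochner_Integration.integral_sum) auto
        finally show ?thesis by (simp only: integral_mult_right_zero)
      qed
      moreover have "(\<integral>u. (\<Sum>is | length is = s. K u * mono_list is u * (\<integral>t. taylor_weight s h t * \<Psi> is (t *\<^sub>R u) \<partial>lborel)) \<partial>lborel)
        = (\<Sum>is | length is = s. \<integral>u. K u * mono_list is u * (\<integral>t. taylor_weight s h t * \<Psi> is (t *\<^sub>R u) \<partial>lborel) \<partial>lborel)"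
        by (intro Bochner_Integration.integral_sum) (simp add: iT')
      ultimately show ?thesis
        using i1 iT' by (subst Bochner_Integration.integral_add)
          (auto intro!: Bochner_Integration.integrable_sum simp del: integrable_mult_right_iff)
    qed
    \<comment> \<open>The moments of nonempty lists shorter than s vanish, so only the empty list
      survives; it occurs in the sum because 1 <= s.\<close>
    also have "(\<Sum>k<s. \<Sum>is | length is = k. (h ^ k / fact k * (- 1) ^ k * P is) * (\<integral>u. K u * mono_list is u \<partial>lborel)) = P []"
    proof -
      have "(\<Sum>k<s. \<Sum>is | length is = k. (h ^ k / fact k * (- 1) ^ k * P is) * (\<integral>u. K u * mono_list is u \<partial>lborel))
          = (\<Sum>k<s. if k = 0 then P [] else 0)"
      proof (intro sum.cong refl)
        fix k assume "k \<in> {..<s}"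
        then have "(\<Sum>is | length is = k. (h ^ k / fact k * (- 1) ^ k * P is) * (\<integral>u. K u * mono_list is u \<partial>lborel))
            = (\<Sum>is | length is = k. (h ^ k / fact k * (- 1) ^ k * P is) * (if is = [] then 1 else 0))"
          by (intro sum.cong refl) (simp add: kernel_moment(2)[OF K])
        also have "\<dots> = (if k = 0 then P [] else 0)"
          by (cases "k = 0") (auto intro!: sum.neutral)
        finally show "(\<Sum>is | length is = k. (h ^ k / fact k * (- 1) ^ k * P is) * (\<integral>u. K u * mono_list is u \<partial>lborel))
            = (if k = 0 then P [] else 0)" .
      qed
      also have "\<dots> = P []" using s by simp
      finally show ?thesis .
    qed
    also have "P [] = (\<integral>x. f x * \<phi> x \<partial>lborel)" by (simp add: P_def)
    finally have main: "(\<integral>x. b x * \<phi> x \<partial>lborel) = (\<integral>x. f x * \<phi> x \<partial>lborel) + (\<Sum>is | length is = s. \<integral>x. g is x * \<phi> x \<partial>lborel)"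
      using eT by simp
    have "(\<integral>x. ((b x - f x) - (\<Sum>is | length is = s. g is x)) * \<phi> x \<partial>lborel)
        = (\<integral>x. (b x * \<phi> x - f x * \<phi> x) - (\<Sum>is | length is = s. g is x * \<phi> x) \<partial>lborel)"
      by (simp add: left_diff_distrib sum_distrib_right)
    also have "\<dots> = ((\<integral>x. b x * \<phi> x \<partial>lborel) - (\<integral>x. f x * \<phi> x \<partial>lborel))
        - (\<Sum>is | length is = s. \<integral>x. g is x * \<phi> x \<partial>lborel)"
    proof -
      have "(\<integral>x. (\<Sum>is | length is = s. g is x * \<phi> x) \<partial>lborel) = (\<Sum>is | length is = s. \<integral>x. g is x * \<phi> x \<partial>lborel)"
        by (intro Bochner_Integration.integral_sum) (simp add: ig)
      moreover have "integrable lborel (\<lambda>x. \<Sum>is | length is = s. g is x * \<phi> x)"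
        by (intro Bochner_Integration.integrable_sum) (simp add: ig)
      ultimately show ?thesis
        using ib if' by (simp add: Bochner_Integration.integral_diff Bochner_Integration.integrable_diff)
    qed
    finally show "(\<integral>x. ((b x - f x) - (\<Sum>is | length is = s. g is x)) * \<phi> x \<partial>lborel) = 0"
      using main by simp
  qed
  then show ?thesis
    unfolding b_def g_def by eventually_elim simp
qed

section \<open>The bias in the L^p norm\<close>

text \<open>Each |a i| is at most the p-th root of the sum of the p-th powers. The constant is
  cruder than that of the power-mean inequality, but the argument works for all p > 0.\<close>

lemma abs_sum_powr_le:
  fixes a :: "'i \<Rightarrow> real"
  assumes I: "finite I" and p: "0 < p"
  shows "\<bar>\<Sum>i\<in>I. a i\<bar> powr p \<le> real (card I) powr p * (\<Sum>i\<in>I. \<bar>a i\<bar> powr p)"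
proof -
  define S where "S = (\<Sum>i\<in>I. \<bar>a i\<bar> powr p)"
  have S: "0 \<le> S" unfolding S_def by (intro sum_nonneg) auto
  have "\<bar>a i\<bar> \<le> S powr (1 / p)" if "i \<in> I" for i
  proof -
    have "\<bar>a i\<bar> powr p \<le> S" unfolding S_def using I that by (intro member_le_sum) auto
    then have "(\<bar>a i\<bar> powr p) powr (1 / p) \<le> S powr (1 / p)"
      using p by (intro powr_mono2) auto
    then show ?thesis using p by (simp add: powr_powr)
  qed
  then have "\<bar>\<Sum>i\<in>I. a i\<bar> \<le> real (card I) * S powr (1 / p)"
    by (intro order_trans[OF sum_abs] order_trans[OF sum_bounded_above]) auto
  then have "\<bar>\<Sum>i\<in>I. a i\<bar> powr p \<le> (real (card I) * S powr (1 / p)) powr p"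
    using p by (intro powr_mono2) auto
  also have "\<dots> = real (card I) powr p * S"
    using p S by (simp add: powr_mult powr_powr)
  finally show ?thesis by (simp add: S_def)
qed

text \<open>The Sobolev norm is a finite sum of nonnegative terms, so each is at most r.
  \<open>Lp_norm\<close> passes through \<open>enn2real\<close>, which sends infinity to 0;
  membership in L^p excludes this case on the way back to \<open>Lp_norm_pow\<close>.\<close>

lemma sobolev_ball_weak_deriv:
  fixes f :: "real^'d::finite \<Rightarrow> real"
  assumes f: "f \<in> sobolev_ball s p r" and l: "length is \<le> s" and p: "1 \<le> p"
  defines "g \<equiv> weak_deriv (count_list is) f"
  shows "has_weak_deriv (count_list is) f g" "in_Lp p g" "Lp_norm_pow p g \<le> ennreal (r powr p)"
proof -
  let ?\<alpha> = "count_list is"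
  have le: "mi_order ?\<alpha> \<le> s" using l by (simp add: mi_order_count_list)
  then have ex: "\<exists>g. has_weak_deriv ?\<alpha> f g" and Lp: "in_Lp p g"
    using f unfolding sobolev_ball_def sobolev_def g_def by blast+
  from someI_ex[OF ex] show "has_weak_deriv ?\<alpha> f g" by (simp add: g_def weak_deriv_def)
  show "in_Lp p g" by fact
  have "Lp_norm p (weak_deriv ?\<alpha> f) \<le> sobolev_norm s p f"
    unfolding sobolev_norm_def
    by (rule member_le_sum) (use le finite_mi_order_le in \<open>auto simp: Lp_norm_def\<close>)
  also have "\<dots> \<le> r" using f by (simp add: sobolev_ball_def)
  finally have n: "enn2real (Lp_norm_pow p g) powr (1 / p) \<le> r" by (simp add: Lp_norm_def g_def)
  have "enn2real (Lp_norm_pow p g) = (enn2real (Lp_norm_pow p g) powr (1 / p)) powr p"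
    using p by (simp add: powr_powr)
  also have "\<dots> \<le> r powr p" using n p by (intro powr_mono2) auto
  finally have "ennreal (enn2real (Lp_norm_pow p g)) \<le> ennreal (r powr p)" by (rule ennreal_leI)
  moreover have "ennreal (enn2real (Lp_norm_pow p g)) = Lp_norm_pow p g"
    using Lp by (simp add: in_Lp_def)
  ultimately show "Lp_norm_pow p g \<le> ennreal (r powr p)" by (simp only:)
qed

text \<open>The Sobolev norm contains the chosen weak derivative of order zero rather than
  \<open>f\<close> itself. Identifying the two almost everywhere is what bounds the L^p norm of
  \<open>f\<close> by r.\<close>

lemma weak_deriv_Nil_AE_eq:
  fixes f :: "real^'d::finite \<Rightarrow> real"
  assumes "has_weak_deriv (count_list []) f g"
  shows "AE x in lborel. f x = g x"
proof -
  have li: "locally_integrable f" "locally_integrable g" using assms by (auto simp: has_weak_deriv_def)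
  have "AE x in lborel. f x - g x = 0"
  proof (rule fundamental_lemma_calculus_of_variations)
    show "locally_integrable (\<lambda>x. f x - g x)" using li by (rule locally_integrable_diff)
    fix \<phi> :: "real^'d \<Rightarrow> real" assume \<phi>: "test_function \<phi>"
    \<comment> \<open>Needed to split the integral of the difference: both functions are only
      locally integrable, and the compact support of \<open>\<phi>\<close> makes the products
      integrable.\<close>
    have int: "integrable lborel (\<lambda>x. w x * \<phi> x)" if w: "locally_integrable w" for w
    proof -
      let ?C = "closure {x. \<phi> x \<noteq> 0}"
      have [measurable]: "\<phi> \<in> borel_measurable borel" using test_function_measurable[OF \<phi>, of "[]"] by simp
      obtain B where B: "\<And>x. \<bar>\<phi> x\<bar> \<le> B" using test_function_bounded[OF \<phi>, of "[]"] by auto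
      have "set_integrable lborel ?C w"
        using w \<phi> by (simp add: locally_integrable_def test_function_def)
      then have "integrable lborel (\<lambda>x. (indicator ?C x * w x) * \<phi> x)"
        unfolding set_integrable_def real_scaleR_def by (rule integrable_mult_bounded[OF _ _ B]) measurable
      moreover have "(indicator ?C x * w x) * \<phi> x = w x * \<phi> x" for x
        using test_function_iter_partial_zero[OF \<phi>, of x "[]"] by (cases "x \<in> ?C") auto
      ultimately show ?thesis by (simp only:)
    qed
    have "(\<integral>x. f x * \<phi> x \<partial>lborel) = (\<integral>x. g x * \<phi> x \<partial>lborel)"
      using weak_deriv_translate[OF assms \<phi>, of 0] by simp
    then show "(\<integral>x. (f x - g x) * \<phi> x \<partial>lborel) = 0"
      using int[OF li(1)] int[OF li(2)] by (simp add: left_diff_distrib)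
  qed
  then show ?thesis by eventually_elim simp
qed

lemma sobolev_ball_Lp_norm_pow_le:
  fixes f :: "real^'d::finite \<Rightarrow> real"
  assumes f: "f \<in> sobolev_ball s p r" and p: "1 \<le> p"
  shows "Lp_norm_pow p f \<le> ennreal (r powr p)"
proof -
  note g = sobolev_ball_weak_deriv[OF f _ p, of "[]"]
  have "Lp_norm_pow p f = Lp_norm_pow p (weak_deriv (count_list []) f)"
    unfolding Lp_norm_pow_def using weak_deriv_Nil_AE_eq[OF g(1)]
    by (intro nn_integral_cong_AE) auto
  then show ?thesis using g(3) by simp
qed

text \<open>One summand for each list of s directions: the mass of the kernel from Young's
  inequality and r^p from the weak derivative. The factor in front is the price of splitting the
  p-th power of the sum.\<close>

definition bias_const :: "nat \<Rightarrow> real \<Rightarrow> real \<Rightarrow> (real^'d::finite \<Rightarrow> real) \<Rightarrow> real" where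
  "bias_const s p r K = real (card {is :: 'd list. length is = s}) powr p *
     (\<Sum>is | length is = s. (\<integral>u. \<bar>K u * mono_list is u\<bar> \<partial>lborel) powr p * r powr p)"

lemma kernel_bias_Lp_norm_pow_le:
  fixes f K :: "real^'d::finite \<Rightarrow> real"
  assumes K: "K \<in> kernels s" and s: "1 \<le> s" and h: "0 < h" and p: "1 \<le> p"
    and f: "integrable lborel f" and fs: "f \<in> sobolev_ball s p r"
  shows "Lp_norm_pow p (\<lambda>x. (\<integral>u. K u * f (x + h *\<^sub>R u) \<partial>lborel) - f x)
    \<le> ennreal (bias_const s p r K * h powr (real s * p))"
proof -
  let ?M = "lborel \<Otimes>\<^sub>M lborel :: ((real^'d) \<times> real) measure"
  have M: "sigma_finite_measure ?M"
    by (simp add: lborel_prod sigma_finite_lborel)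
  have \<tau>[measurable]: "(\<lambda>z. snd z *\<^sub>R fst z) \<in> borel_measurable ?M" by measurable
  define G where "G is = weak_deriv (count_list is) f" for "is"
  note W = sobolev_ball_weak_deriv[OF fs _ p, folded G_def]
  define L where "L = {is :: 'd list. length is = s}"
  have finL: "finite L" unfolding L_def by (rule finite_lists_length)
  define g where "g is x = (\<integral>z. taylor_kernel s h K is z * G is (x + snd z *\<^sub>R fst z) \<partial>?M)" for "is" x
  define c where "c = real (card L) powr p"
  define \<kappa> where "\<kappa> is = (\<integral>u. \<bar>K u * mono_list is u\<bar> \<partial>lborel)" for "is"
  have gm: "g is \<in> borel_measurable borel" if "is \<in> L" for "is"
    using locally_integrable_shift_average[OF M integrable_taylor_kernel[OF K _ h] W(2) \<tau> p, of "is" "is"] that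
    unfolding g_def L_def locally_integrable_def by auto
  have "Lp_norm_pow p (\<lambda>x. (\<integral>u. K u * f (x + h *\<^sub>R u) \<partial>lborel) - f x)
      = (\<integral>\<^sup>+ x. ennreal (\<bar>\<Sum>is\<in>L. g is x\<bar> powr p) \<partial>lborel)"
    unfolding Lp_norm_pow_def
  proof (rule nn_integral_cong_AE)
    have "AE x in lborel. (\<integral>u. K u * f (x + h *\<^sub>R u) \<partial>lborel) - f x = (\<Sum>is\<in>L. g is x)"
      unfolding g_def L_def by (rule kernel_bias_representation[OF K s h p f]) (auto simp: W)
    then show "AE x in lborel. ennreal (\<bar>(\<integral>u. K u * f (x + h *\<^sub>R u) \<partial>lborel) - f x\<bar> powr p)
      = ennreal (\<bar>\<Sum>is\<in>L. g is x\<bar> powr p)"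
      by eventually_elim simp
  qed
  also have "\<dots> \<le> (\<integral>\<^sup>+ x. ennreal c * (\<Sum>is\<in>L. ennreal (\<bar>g is x\<bar> powr p)) \<partial>lborel)"
  proof (rule nn_integral_mono)
    fix x
    have "ennreal (\<bar>\<Sum>is\<in>L. g is x\<bar> powr p) \<le> ennreal (c * (\<Sum>is\<in>L. \<bar>g is x\<bar> powr p))"
      unfolding c_def using finL p by (intro ennreal_leI abs_sum_powr_le) auto
    then show "ennreal (\<bar>\<Sum>is\<in>L. g is x\<bar> powr p) \<le> ennreal c * (\<Sum>is\<in>L. ennreal (\<bar>g is x\<bar> powr p))"
      by (simp add: ennreal_mult sum_nonneg c_def)
  qed
  also have "\<dots> = ennreal c * (\<Sum>is\<in>L. \<integral>\<^sup>+ x. ennreal (\<bar>g is x\<bar> powr p) \<partial>lborel)"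
  proof -
    have "(\<integral>\<^sup>+ x. (\<Sum>is\<in>L. ennreal (\<bar>g is x\<bar> powr p)) \<partial>lborel) = (\<Sum>is\<in>L. \<integral>\<^sup>+ x. ennreal (\<bar>g is x\<bar> powr p) \<partial>lborel)"
      using gm by (intro nn_integral_sum) auto
    moreover have "(\<lambda>x. \<Sum>is\<in>L. ennreal (\<bar>g is x\<bar> powr p)) \<in> borel_measurable lborel"
      using gm by (intro borel_measurable_sum) auto
    ultimately show ?thesis by (simp add: nn_integral_cmult)
  qed
  also have "\<dots> \<le> ennreal c * (\<Sum>is\<in>L. ennreal (\<kappa> is powr p * r powr p * h powr (real s * p)))"
  proof (intro mult_left_mono sum_mono)
    fix "is" assume "is \<in> L"
    then have l: "length is = s" by (simp add: L_def)
    have "(\<integral>\<^sup>+ x. ennreal (\<bar>g is x\<bar> powr p) \<partial>lborel)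
        \<le> ennreal ((\<integral>z. \<bar>taylor_kernel s h K is z\<bar> \<partial>?M) powr p) * Lp_norm_pow p (G is)"
      unfolding g_def using W(2)[of "is"] l
      by (intro nn_integral_shift_average_powr_le[OF M integrable_taylor_kernel[OF K l h] _ \<tau> p]) (simp add: in_Lp_def)
    also have "\<dots> \<le> ennreal ((\<kappa> is * h ^ s) powr p) * ennreal (r powr p)"
      unfolding \<kappa>_def using W(3)[of "is"] l p
      by (intro mult_mono ennreal_leI powr_mono2 integral_abs_taylor_kernel_le[OF K l h s]) auto
    also have "\<dots> = ennreal (\<kappa> is powr p * r powr p * h powr (real s * p))"
      using h by (simp flip: ennreal_mult add: powr_mult powr_powr powr_realpow[symmetric] mult_ac \<kappa>_def)
    finally show "(\<integral>\<^sup>+ x. ennreal (\<bar>g is x\<bar> powr p) \<partial>lborel) \<le> ennreal (\<kappa> is powr p * r powr p * h powr (real s * p))" .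
  qed auto
  also have "\<dots> = ennreal (bias_const s p r K * h powr (real s * p))"
    by (simp flip: ennreal_mult add: sum_nonneg bias_const_def c_def L_def \<kappa>_def sum_distrib_right sum_distrib_left mult.assoc)
  finally show ?thesis .
qed

section \<open>Stochastic error and risk\<close>

lemma prob_density_measure:
  fixes f :: "'a::euclidean_space \<Rightarrow> real"
  assumes f: "prob_density f"
  defines "D \<equiv> density lborel (\<lambda>x. ennreal (f x))"
  shows "prob_space D"
    and "\<And>g. g \<in> borel_measurable borel \<Longrightarrow> (\<integral>x. g x \<partial>D) = (\<integral>x. f x * g x \<partial>lborel)"
proof -
  have nn: "AE x in lborel. 0 \<le> f x" and i: "integrable lborel f" and 1: "(\<integral>x. f x \<partial>lborel) = 1"
    using f by (auto simp: prob_density_def has_bochner_integral_iff)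
  have [measurable]: "f \<in> borel_measurable borel" using i by auto
  have "(\<integral>\<^sup>+ x. ennreal (f x) \<partial>lborel) = 1"
    using i nn 1 by (subst nn_integral_eq_integral) auto
  then show "prob_space D"
    unfolding D_def by (intro prob_spaceI) (simp add: emeasure_density)
  show "(\<integral>x. g x \<partial>D) = (\<integral>x. f x * g x \<partial>lborel)" if "g \<in> borel_measurable borel" for g :: "'a \<Rightarrow> real"
    unfolding D_def using that nn by (subst integral_density) auto
qed

text \<open>Substituting y = x + h u produces the factor h^d. Applied to \<open>K\<close> this
  identifies the mean of the estimator, applied to the square of \<open>K\<close> the second moment
  of a summand.\<close>

lemma expectation_kernel:
  fixes f K :: "real^'d::finite \<Rightarrow> real"
  assumes f: "prob_density f" and K[measurable]: "K \<in> borel_measurable borel"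
    and h: "0 < h"
  defines "D \<equiv> density lborel (\<lambda>x. ennreal (f x))"
  shows "(\<integral>y. K ((y - x) /\<^sub>R h) \<partial>D) = h ^ CARD('d) * (\<integral>u. K u * f (x + h *\<^sub>R u) \<partial>lborel)"
proof -
  have [measurable]: "f \<in> borel_measurable borel"
    using f by (auto simp: prob_density_def has_bochner_integral_iff)
  have "(\<integral>y. K ((y - x) /\<^sub>R h) \<partial>D) = (\<integral>y. f y * K ((y - x) /\<^sub>R h) \<partial>lborel)"
    unfolding D_def by (rule prob_density_measure(2)[OF f]) measurable
  also have "\<dots> = \<bar>h\<bar> ^ DIM(real^'d) * (\<integral>u. f (x + h *\<^sub>R u) * K ((x + h *\<^sub>R u - x) /\<^sub>R h) \<partial>lborel)"
    using h by (intro lborel_integral_affine) auto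
  finally show ?thesis using h by (simp add: mult.commute)
qed

text \<open>The constant of Rosenthal's inequality. The centred summands are bounded by 2 m, so
  their q-th moment is at most (2 m)^(q - 2) times their variance.\<close>

definition stoch_const :: "real \<Rightarrow> real \<Rightarrow> real" where
  "stoch_const q m = 2 * (powr_taylor_const q powr (q / 2) + powr_taylor_const q * (2 * m) powr (q - 2))"

lemma stoch_const_nonneg: "2 \<le> q \<Longrightarrow> 0 \<le> stoch_const q m"
  unfolding stoch_const_def using powr_taylor_const_pos[of q] by (intro mult_nonneg_nonneg add_nonneg_nonneg) auto

text \<open>With N = n h^d the deviation is a sum of n centred variables divided by N. Their
  variance is at most h^d g, so Rosenthal's inequality gives N^(q/2) g^(q/2) + N g up to constants.
  The result follows on dividing by N^q.\<close>

lemma kde_deviation_moment_le: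
  fixes f K :: "real^'d::finite \<Rightarrow> real" and x :: "real^'d"
  assumes f: "prob_density f" and K[measurable]: "K \<in> borel_measurable borel"
    and bound: "\<And>u. \<bar>K u\<bar> \<le> m" and m: "0 < m"
    and h: "0 < h" and n: "1 \<le> n" and N: "1 \<le> real n * h ^ CARD('d)" and q: "2 \<le> q"
  defines "g \<equiv> \<integral>u. (K u)\<^sup>2 * f (x + h *\<^sub>R u) \<partial>lborel"
  shows "0 \<le> g"
    and "(\<integral>\<^sup>+ X. ennreal (\<bar>kde K h n X x - (\<integral>u. K u * f (x + h *\<^sub>R u) \<partial>lborel)\<bar> powr q) \<partial>sample_measure n f)
      \<le> ennreal ((real n * h ^ CARD('d)) powr (- q / 2) * stoch_const q m * (g powr (q / 2) + g))"
proof -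
  define D where "D = density lborel (\<lambda>x. ennreal (f x))"
  interpret D: prob_space D unfolding D_def by (rule prob_density_measure(1)[OF f])
  define Y where "Y y = K ((y - x) /\<^sub>R h)" for y
  have Ym[measurable]: "Y \<in> borel_measurable borel" unfolding Y_def by measurable
  have YD: "Y \<in> borel_measurable D" unfolding D_def by simp
  have Yb: "\<bar>Y y\<bar> \<le> m" for y using bound by (simp add: Y_def)
  define \<mu> where "\<mu> = D.expectation Y"
  define Z where "Z y = Y y - \<mu>" for y
  have ZD[measurable]: "Z \<in> borel_measurable D" unfolding Z_def using YD by measurable
  let ?hd = "h ^ CARD('d)" and ?C = "powr_taylor_const q"
  have hd: "0 < ?hd" using h by simp
  define N where "N = real n * ?hd"
  have N1: "1 \<le> N" using N by (simp add: N_def)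
  have C: "0 < ?C" using powr_taylor_const_pos[OF q] .
  have iY: "integrable D Y" using YD Yb by (intro D.integrable_const_bound[of _ m]) auto
  have iY2: "integrable D (\<lambda>y. (Y y)\<^sup>2)"
  proof (rule D.integrable_const_bound[of _ "m\<^sup>2"])
    show "AE x in D. norm ((Y x)\<^sup>2) \<le> m\<^sup>2"
      using Yb m by (auto simp: abs_le_square_iff[symmetric])
  qed (use YD in measurable)
  have \<mu>: "\<mu> = ?hd * (\<integral>u. K u * f (x + h *\<^sub>R u) \<partial>lborel)"
    unfolding \<mu>_def Y_def D_def by (rule expectation_kernel[OF f K h])
  have EY2: "D.expectation (\<lambda>y. (Y y)\<^sup>2) = ?hd * g"
    unfolding g_def Y_def D_def by (rule expectation_kernel[OF f _ h, of "\<lambda>u. (K u)\<^sup>2"]) measurable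
  have "0 \<le> D.expectation (\<lambda>y. (Y y)\<^sup>2)" by (intro integral_nonneg_AE) auto
  then show g: "0 \<le> g" using hd unfolding EY2 by (simp add: zero_le_mult_iff)
  have "\<bar>\<mu>\<bar> \<le> D.expectation (\<lambda>y. \<bar>Y y\<bar>)" unfolding \<mu>_def by (rule integral_abs_bound)
  also have "\<dots> \<le> D.expectation (\<lambda>y. m)"
    using iY Yb by (intro integral_mono) auto
  finally have \<mu>b: "\<bar>\<mu>\<bar> \<le> m" by (simp add: D.prob_space)
  have Zb: "\<bar>Z y\<bar> \<le> 2 * m" for y
    using Yb[of y] \<mu>b unfolding Z_def by linarith
  have EZ: "D.expectation Z = 0"
    unfolding Z_def using iY by (simp add: \<mu>_def D.prob_space)
  have "D.expectation (\<lambda>y. (Z y)\<^sup>2) = D.expectation (\<lambda>y. (Y y)\<^sup>2) - \<mu>\<^sup>2"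
    unfolding Z_def \<mu>_def by (rule D.variance_eq[OF iY iY2])
  then have EZ2: "D.expectation (\<lambda>y. (Z y)\<^sup>2) \<le> ?hd * g" unfolding EY2 by simp
  have iZ2: "integrable D (\<lambda>y. (Z y)\<^sup>2)"
    unfolding Z_def using iY iY2 by (simp add: power2_diff)
  have Zq: "\<bar>Z y\<bar> powr q \<le> (2 * m) powr (q - 2) * (Z y)\<^sup>2" for y
  proof (cases "Z y = 0")
    case False
    have "\<bar>Z y\<bar> powr q = \<bar>Z y\<bar> powr (q - 2) * \<bar>Z y\<bar> powr 2"
      by (simp only: powr_add[symmetric] diff_add_cancel)
    also have "\<bar>Z y\<bar> powr 2 = (Z y)\<^sup>2" by simp
    also have "\<bar>Z y\<bar> powr (q - 2) * (Z y)\<^sup>2 \<le> (2 * m) powr (q - 2) * (Z y)\<^sup>2"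
      using Zb q by (intro mult_right_mono powr_mono2) auto
    finally show ?thesis .
  qed (use q in simp)
  have "D.expectation (\<lambda>y. \<bar>Z y\<bar> powr q) \<le> D.expectation (\<lambda>y. (2 * m) powr (q - 2) * (Z y)\<^sup>2)"
  proof (intro integral_mono)
    show "integrable D (\<lambda>y. \<bar>Z y\<bar> powr q)"
      by (rule Bochner_Integration.integrable_bound[of D "\<lambda>y. (2 * m) powr (q - 2) * (Z y)\<^sup>2"])
         (use iZ2 Zq in auto)
  qed (use iZ2 Zq in auto)
  also have "\<dots> \<le> (2 * m) powr (q - 2) * (?hd * g)"
    using EZ2 by (simp add: mult_left_mono)
  finally have EZq: "D.expectation (\<lambda>y. \<bar>Z y\<bar> powr q) \<le> (2 * m) powr (q - 2) * (?hd * g)" .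
  define R where "R = 2 * ((?C * real n * D.expectation (\<lambda>y. (Z y)\<^sup>2)) powr (q / 2)
      + ?C * real n * D.expectation (\<lambda>y. \<bar>Z y\<bar> powr q))"
  have Rosenthal: "(\<integral>\<^sup>+ X. ennreal (\<bar>\<Sum>i=1..n. Z (X i)\<bar> powr q) \<partial>sample_measure n f) \<le> ennreal R"
    using D.Rosenthal_inequality[OF q n ZD Zb EZ] unfolding R_def sample_measure_def D_def .
  have "R \<le> 2 * ((?C * real n * (?hd * g)) powr (q / 2) + ?C * real n * ((2 * m) powr (q - 2) * (?hd * g)))"
    unfolding R_def using C q EZ2 EZq
    by (intro mult_left_mono add_mono powr_mono2 mult_nonneg_nonneg) auto
  also have "\<dots> = 2 * (?C powr (q / 2) * (N powr (q / 2) * g powr (q / 2)) + ?C * (2 * m) powr (q - 2) * (N * g))"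
    using C g N1 hd by (simp add: N_def powr_mult mult_ac)
  also have "\<dots> \<le> 2 * (?C powr (q / 2) * (N powr (q / 2) * (g powr (q / 2) + g))
      + ?C * (2 * m) powr (q - 2) * (N powr (q / 2) * (g powr (q / 2) + g)))"
  proof -
    \<comment> \<open>Here 1 <= N is used: the linear term of Rosenthal's inequality is absorbed, so
      that both terms scale like N^(q/2).\<close>
    have "N powr 1 \<le> N powr (q / 2)" using N1 q by (intro powr_mono) auto
    then have 1: "N * g \<le> N powr (q / 2) * (g powr (q / 2) + g)"
      using N1 g by (intro mult_mono) auto
    have 2: "N powr (q / 2) * g powr (q / 2) \<le> N powr (q / 2) * (g powr (q / 2) + g)"
      using g by (intro mult_left_mono) auto
    show ?thesis
      using C by (intro mult_left_mono[OF add_mono[OF mult_left_mono[OF 2] mult_left_mono[OF 1]]]) auto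
  qed
  also have "\<dots> = N powr (q / 2) * stoch_const q m * (g powr (q / 2) + g)"
    by (simp add: stoch_const_def algebra_simps)
  finally have R: "R \<le> N powr (q / 2) * stoch_const q m * (g powr (q / 2) + g)" .
  have eq: "kde K h n X x - (\<integral>u. K u * f (x + h *\<^sub>R u) \<partial>lborel) = (\<Sum>i=1..n. Z (X i)) / N" for X
  proof -
    have "(\<Sum>i=1..n. Z (X i)) = (\<Sum>i=1..n. Y (X i)) - real n * \<mu>"
      by (simp add: Z_def sum_subtractf)
    moreover have "real n * \<mu> = N * (\<integral>u. K u * f (x + h *\<^sub>R u) \<partial>lborel)"
      by (simp add: \<mu> N_def)
    ultimately have "(\<Sum>i=1..n. Z (X i)) / N = (\<Sum>i=1..n. Y (X i)) / N - (\<integral>u. K u * f (x + h *\<^sub>R u) \<partial>lborel)"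
      using N1 by (simp add: diff_divide_distrib)
    then show ?thesis by (simp add: kde_def Y_def N_def)
  qed
  have Zs: "(\<lambda>X. ennreal (\<bar>\<Sum>i=1..n. Z (X i)\<bar> powr q)) \<in> borel_measurable (sample_measure n f)"
    unfolding sample_measure_def D_def[symmetric] by measurable
  have "(\<integral>\<^sup>+ X. ennreal (\<bar>kde K h n X x - (\<integral>u. K u * f (x + h *\<^sub>R u) \<partial>lborel)\<bar> powr q) \<partial>sample_measure n f)
      = (\<integral>\<^sup>+ X. ennreal (N powr (- q)) * ennreal (\<bar>\<Sum>i=1..n. Z (X i)\<bar> powr q) \<partial>sample_measure n f)"
  proof (intro nn_integral_cong)
    fix X
    have "\<bar>(\<Sum>i=1..n. Z (X i)) / N\<bar> powr q = N powr (- q) * \<bar>\<Sum>i=1..n. Z (X i)\<bar> powr q"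
      using N1 by (simp add: abs_divide powr_divide powr_minus_divide)
    then show "ennreal (\<bar>kde K h n X x - (\<integral>u. K u * f (x + h *\<^sub>R u) \<partial>lborel)\<bar> powr q)
        = ennreal (N powr (- q)) * ennreal (\<bar>\<Sum>i=1..n. Z (X i)\<bar> powr q)"
      unfolding eq by (simp add: ennreal_mult)
  qed
  also have "\<dots> = ennreal (N powr (- q)) * (\<integral>\<^sup>+ X. ennreal (\<bar>\<Sum>i=1..n. Z (X i)\<bar> powr q) \<partial>sample_measure n f)"
    by (rule nn_integral_cmult[OF Zs])
  also have "\<dots> \<le> ennreal (N powr (- q)) * ennreal (N powr (q / 2) * stoch_const q m * (g powr (q / 2) + g))"
    by (intro mult_left_mono order_trans[OF Rosenthal ennreal_leI[OF R]]) auto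
  also have "\<dots> = ennreal (N powr (- q) * (N powr (q / 2) * stoch_const q m * (g powr (q / 2) + g)))"
    using g stoch_const_nonneg[OF q] by (simp flip: ennreal_mult)
  also have "N powr (- q) * (N powr (q / 2) * stoch_const q m * (g powr (q / 2) + g))
      = N powr (- q / 2) * stoch_const q m * (g powr (q / 2) + g)"
  proof -
    have "N powr (- q) * N powr (q / 2) = N powr (- q / 2)"
      by (simp flip: powr_add)
    then show ?thesis by (simp flip: mult.assoc)
  qed
  finally show "(\<integral>\<^sup>+ X. ennreal (\<bar>kde K h n X x - (\<integral>u. K u * f (x + h *\<^sub>R u) \<partial>lborel)\<bar> powr q) \<partial>sample_measure n f)
      \<le> ennreal ((real n * ?hd) powr (- q / 2) * stoch_const q m * (g powr (q / 2) + g))"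
    by (simp add: N_def)
qed

lemma prob_density_Lp_norm_pow_1:
  assumes "prob_density f"
  shows "Lp_norm_pow 1 f = 1"
proof -
  have nn: "AE x in lborel. 0 \<le> f x" and i: "integrable lborel f" and 1: "(\<integral>x. f x \<partial>lborel) = 1"
    using assms by (auto simp: prob_density_def has_bochner_integral_iff)
  have "Lp_norm_pow 1 f = (\<integral>\<^sup>+ x. ennreal (f x) \<partial>lborel)"
    unfolding Lp_norm_pow_def using nn by (intro nn_integral_cong_AE) (auto elim!: eventually_mono)
  also have "\<dots> = 1" using i nn 1 by (subst nn_integral_eq_integral) auto
  finally show ?thesis .
qed

lemma kernels_square_integrable:
  assumes K: "K \<in> kernels s" and bound: "\<And>u. \<bar>K u\<bar> \<le> m"
  shows "integrable lborel (\<lambda>u. (K u)\<^sup>2)"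
proof -
  have "integrable lborel K" using K by (auto simp: kernels_def has_bochner_integral_iff)
  moreover have "K \<in> borel_measurable lborel" using K by (simp add: kernels_def)
  ultimately show ?thesis
    unfolding power2_eq_square by (rule integrable_mult_bounded) (rule bound)
qed

lemma sample_measure_prob_space: "prob_density f \<Longrightarrow> prob_space (sample_measure n f)"
  unfolding sample_measure_def by (rule prob_space_PiM) (rule prob_density_measure(1))

text \<open>Joint measurability in the sample and the point, as required for exchanging expectation
  and integration over space.\<close>

lemma measurable_kde:
  assumes [measurable]: "K \<in> borel_measurable borel"
  shows "(\<lambda>(X, x). kde K h n X x) \<in> borel_measurable (sample_measure n f \<Otimes>\<^sub>M lborel)"
proof -
  have [measurable]: "(\<lambda>X. X i) \<in> borel_measurable (sample_measure n f)" if "i \<in> {1..n}" for i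
  proof -
    have "(\<lambda>X. X i) \<in> measurable (sample_measure n f) (density lborel (\<lambda>x. ennreal (f x)))"
      unfolding sample_measure_def using that by (rule measurable_component_singleton)
    then show ?thesis by (simp cong: measurable_cong_sets)
  qed
  show ?thesis unfolding kde_def by measurable
qed

text \<open>The constant counts \<open>g\<close> twice, once from the pointwise bound and once from
  g^(p/2) <= g + g^p. The integral of \<open>g\<close> is at most \<kappa> because \<open>f\<close>
  is a density; r enters only through the integral of g^p.\<close>

lemma kde_deviation_Lp_le:
  fixes f K :: "real^'d::finite \<Rightarrow> real"
  assumes f: "prob_density f" and fs: "f \<in> sobolev_ball s p r" and K: "K \<in> kernels s"
    and bound: "\<And>u. \<bar>K u\<bar> \<le> m" and m: "0 < m"
    and h: "0 < h" and n: "1 \<le> n" and N: "1 \<le> real n * h ^ CARD('d)" and p: "2 \<le> p"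
  defines "\<kappa> \<equiv> \<integral>u. (K u)\<^sup>2 \<partial>lborel"
  shows "(\<integral>\<^sup>+ x. \<integral>\<^sup>+ X. ennreal (\<bar>kde K h n X x - (\<integral>u. K u * f (x + h *\<^sub>R u) \<partial>lborel)\<bar> powr p) \<partial>sample_measure n f \<partial>lborel)
      \<le> ennreal (stoch_const p m * (2 * \<kappa> + \<kappa> powr p * r powr p) * (real n * h ^ CARD('d)) powr (- p / 2))"
proof -
  have [measurable]: "K \<in> borel_measurable borel" using K by (simp add: kernels_def)
  have [measurable]: "f \<in> borel_measurable borel" using f by (auto simp: prob_density_def has_bochner_integral_iff)
  note K2 = kernels_square_integrable[OF K bound]
  have \<kappa>: "0 \<le> \<kappa>" unfolding \<kappa>_def by simp
  define g where "g x = (\<integral>u. (K u)\<^sup>2 * f (x + h *\<^sub>R u) \<partial>lborel)" for x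
  have gm[measurable]: "g \<in> borel_measurable borel" unfolding g_def by measurable
  note dev = kde_deviation_moment_le[OF f \<open>K \<in> borel_measurable borel\<close> bound m h n N p]
  have g0: "0 \<le> g x" for x unfolding g_def by (rule dev(1))
  define A where "A = (real n * h ^ CARD('d)) powr (- p / 2) * stoch_const p m"
  have A: "0 \<le> A" using stoch_const_nonneg[OF p] by (simp add: A_def)
  have "(\<integral>\<^sup>+ x. ennreal (\<bar>g x\<bar> powr 1) \<partial>lborel) \<le> ennreal ((\<integral>u. \<bar>(K u)\<^sup>2\<bar> \<partial>lborel) powr 1) * Lp_norm_pow 1 f"
    unfolding g_def by (intro nn_integral_shift_average_powr_le[OF sigma_finite_lborel K2]) auto
  then have g1: "(\<integral>\<^sup>+ x. ennreal (g x) \<partial>lborel) \<le> ennreal \<kappa>"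
    using g0 \<kappa> by (simp add: prob_density_Lp_norm_pow_1[OF f] \<kappa>_def)
  have "(\<integral>\<^sup>+ x. ennreal (\<bar>g x\<bar> powr p) \<partial>lborel) \<le> ennreal ((\<integral>u. \<bar>(K u)\<^sup>2\<bar> \<partial>lborel) powr p) * Lp_norm_pow p f"
    unfolding g_def using p by (intro nn_integral_shift_average_powr_le[OF sigma_finite_lborel K2]) auto
  also have "\<dots> \<le> ennreal (\<kappa> powr p) * ennreal (r powr p)"
    using sobolev_ball_Lp_norm_pow_le[OF fs] p by (simp add: \<kappa>_def mult_left_mono)
  finally have gp: "(\<integral>\<^sup>+ x. ennreal (g x powr p) \<partial>lborel) \<le> ennreal (\<kappa> powr p * r powr p)"
    using g0 by (simp add: ennreal_mult)
  have "(\<integral>\<^sup>+ x. \<integral>\<^sup>+ X. ennreal (\<bar>kde K h n X x - (\<integral>u. K u * f (x + h *\<^sub>R u) \<partial>lborel)\<bar> powr p) \<partial>sample_measure n f \<partial>lborel)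
      \<le> (\<integral>\<^sup>+ x. ennreal A * (2 * ennreal (g x) + ennreal (g x powr p)) \<partial>lborel)"
  proof (rule nn_integral_mono)
    fix x
    have "g x powr (p / 2) \<le> g x + g x powr p"
    proof (cases "g x \<le> 1")
      case True
      then have "g x powr (p / 2) \<le> g x powr 1"
        using g0[of x] p by (intro powr_mono') auto
      then show ?thesis using g0[of x] by (simp add: add_increasing2)
    next
      case False
      then have "g x powr (p / 2) \<le> g x powr p" using p by (intro powr_mono) auto
      then show ?thesis using g0[of x] by simp
    qed
    then have "A * (g x powr (p / 2) + g x) \<le> A * (2 * g x + g x powr p)"
      using A by (intro mult_left_mono) auto
    then have "ennreal (A * (g x powr (p / 2) + g x)) \<le> ennreal A * (2 * ennreal (g x) + ennreal (g x powr p))"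
      using A g0[of x] by (simp flip: ennreal_mult ennreal_plus ennreal_numeral add: ennreal_leI)
    then show "(\<integral>\<^sup>+ X. ennreal (\<bar>kde K h n X x - (\<integral>u. K u * f (x + h *\<^sub>R u) \<partial>lborel)\<bar> powr p) \<partial>sample_measure n f)
        \<le> ennreal A * (2 * ennreal (g x) + ennreal (g x powr p))"
      using dev(2)[of x] unfolding A_def g_def by (rule order_trans[rotated])
  qed
  also have "\<dots> = ennreal A * (2 * (\<integral>\<^sup>+ x. ennreal (g x) \<partial>lborel) + (\<integral>\<^sup>+ x. ennreal (g x powr p) \<partial>lborel))"
    by (simp add: nn_integral_cmult nn_integral_add)
  also have "\<dots> \<le> ennreal A * (2 * ennreal \<kappa> + ennreal (\<kappa> powr p * r powr p))"
    by (intro mult_left_mono add_mono g1 gp) auto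
  also have "\<dots> = ennreal (A * (2 * \<kappa> + \<kappa> powr p * r powr p))"
    using A \<kappa> by (simp flip: ennreal_mult ennreal_plus ennreal_numeral)
  finally show ?thesis by (simp add: A_def mult_ac)
qed

text \<open>For \<open>p < 2\<close> only second moments are used: \<open>\<bar>T\<bar>^p \<le> 1 + T^2\<close> for the deviation \<open>T\<close> scaled by
  \<open>sqrt N\<close>, and \<open>T\<close> vanishes off a ball whose radius does not depend on \<open>f\<close>.\<close>

lemma kde_deviation_Lp_le_compact:
  fixes f K :: "real^'d::finite \<Rightarrow> real"
  assumes f: "prob_density f" and K: "K \<in> kernels s"
    and supp: "AE x in lborel. x \<notin> cball x0 R \<longrightarrow> f x = 0"
    and Ksupp: "\<And>u. K u \<noteq> 0 \<Longrightarrow> norm u \<le> \<rho>"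
    and R: "0 \<le> R" and \<rho>: "0 \<le> \<rho>"
    and bound: "\<And>u. \<bar>K u\<bar> \<le> m" and m: "0 < m"
    and h: "0 < h" "h \<le> 1" and n: "1 \<le> n" and N: "1 \<le> real n * h ^ CARD('d)" and p: "1 \<le> p" "p < 2"
  defines "\<kappa> \<equiv> \<integral>u. (K u)\<^sup>2 \<partial>lborel"
  shows "(\<integral>\<^sup>+ x. \<integral>\<^sup>+ X. ennreal (\<bar>kde K h n X x - (\<integral>u. K u * f (x + h *\<^sub>R u) \<partial>lborel)\<bar> powr p) \<partial>sample_measure n f \<partial>lborel)
      \<le> ennreal ((unit_ball_vol (real CARD('d)) * (R + \<rho>) ^ CARD('d) + stoch_const 2 m * (2 * \<kappa>))
          * (real n * h ^ CARD('d)) powr (- p / 2))"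
proof -
  have [measurable]: "K \<in> borel_measurable borel" using K by (simp add: kernels_def)
  have [measurable]: "f \<in> borel_measurable borel" using f by (auto simp: prob_density_def has_bochner_integral_iff)
  interpret S: prob_space "sample_measure n f" by (rule sample_measure_prob_space[OF f])
  note K2 = kernels_square_integrable[OF K bound]
  have \<kappa>: "0 \<le> \<kappa>" unfolding \<kappa>_def by simp
  define g where "g x = (\<integral>u. (K u)\<^sup>2 * f (x + h *\<^sub>R u) \<partial>lborel)" for x
  have gm[measurable]: "g \<in> borel_measurable borel" unfolding g_def by measurable
  have p2: "(2::real) \<le> 2" by simp
  note dev = kde_deviation_moment_le[OF f \<open>K \<in> borel_measurable borel\<close> bound m h(1) n N p2]
  have g0: "0 \<le> g x" for x unfolding g_def by (rule dev(1))
  define N where "N = real n * h ^ CARD('d)"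
  have N1: "1 \<le> N" using assms by (simp add: N_def)
  define A where "A = stoch_const 2 m"
  have A: "0 \<le> A" using stoch_const_nonneg[of 2] by (simp add: A_def)
  \<comment> \<open>Because h <= 1, enlarging the radius by \<rho> suffices for every bandwidth. The
    centre depends on \<open>f\<close>, the volume does not.\<close>
  define B where "B = cball x0 (R + \<rho>)"
  have [measurable]: "B \<in> sets borel" by (simp add: B_def)
  define T where "T X x = kde K h n X x - (\<integral>u. K u * f (x + h *\<^sub>R u) \<partial>lborel)" for X x
  have Tm: "(\<lambda>X. T X x) \<in> borel_measurable (sample_measure n f)" for x
  proof -
    have "(\<lambda>X. (X, x)) \<in> measurable (sample_measure n f) (sample_measure n f \<Otimes>\<^sub>M lborel)" by measurable
    from measurable_compose[OF this measurable_kde[OF \<open>K \<in> borel_measurable borel\<close>]]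
    show ?thesis unfolding T_def by simp
  qed
  have dev2: "(\<integral>\<^sup>+ X. ennreal ((T X x)\<^sup>2) \<partial>sample_measure n f) \<le> ennreal (A / N * (2 * g x))" for x
  proof -
    have "N powr (- 2 / 2) * A * (g x powr (2 / 2) + g x) = A / N * (2 * g x)"
      using N1 g0[of x] by (simp add: powr_minus_divide)
    then show ?thesis
      using dev(2)[of x] by (simp add: T_def g_def[symmetric] N_def[symmetric] A_def[symmetric])
  qed
  \<comment> \<open>If f y and K ((y - x)/h) were both nonzero, y would lie within R of x0 and
    within \<rho> h <= \<rho> of x, which would put x into \<open>B\<close>.\<close>
  have gB: "g x = 0" if x: "x \<notin> B" for x
  proof -
    have "(\<integral>y. (K ((y - x) /\<^sub>R h))\<^sup>2 \<partial>density lborel (\<lambda>x. ennreal (f x))) = (\<integral>y. f y * (K ((y - x) /\<^sub>R h))\<^sup>2 \<partial>lborel)"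
      by (rule prob_density_measure(2)[OF f]) measurable
    also have "\<dots> = (\<integral>y. 0 \<partial>(lborel :: (real^'d) measure))"
    proof (rule integral_cong_AE)
      show "AE y in lborel. f y * (K ((y - x) /\<^sub>R h))\<^sup>2 = 0"
        using supp
      proof eventually_elim
        fix y assume y: "y \<notin> cball x0 R \<longrightarrow> f y = 0"
        show "f y * (K ((y - x) /\<^sub>R h))\<^sup>2 = 0"
        proof (rule ccontr)
          assume "f y * (K ((y - x) /\<^sub>R h))\<^sup>2 \<noteq> 0"
          then have "f y \<noteq> 0" and "K ((y - x) /\<^sub>R h) \<noteq> 0" by auto
          then have "dist x0 y \<le> R" and "norm ((y - x) /\<^sub>R h) \<le> \<rho>"
            using y by (simp, intro Ksupp)
          moreover from this(2) have "norm (y - x) \<le> \<rho> * h"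
            using h by (simp add: divide_simps)
          moreover have "\<rho> * h \<le> \<rho>" using h \<rho> by (simp add: mult_left_le)
          ultimately have "dist x0 x \<le> R + \<rho>"
            using dist_triangle[of x0 x y] by (simp add: dist_norm)
          then show False using x by (simp add: B_def)
        qed
      qed
    qed auto
    finally have "h ^ CARD('d) * g x = 0"
      unfolding g_def by (subst expectation_kernel[OF f _ h(1), of "\<lambda>u. (K u)\<^sup>2", symmetric]) auto
    then show ?thesis using h by simp
  qed
  have "(\<integral>\<^sup>+ X. ennreal (\<bar>T X x\<bar> powr p) \<partial>sample_measure n f)
      \<le> ennreal (N powr (- p / 2)) * (indicator B x + ennreal (2 * A) * ennreal (g x))" for x
  proof (cases "x \<in> B")
    case True
    have pt: "\<bar>t\<bar> powr p \<le> N powr (- p / 2) * (1 + N * t\<^sup>2)" for t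
    proof -
      define v where "v = sqrt N * \<bar>t\<bar>"
      have v: "0 \<le> v" using N1 by (simp add: v_def)
      have "v powr p \<le> 1 + v\<^sup>2"
      proof (cases "v \<le> 1")
        case True
        then have "v powr p \<le> 1 powr p" using v p by (intro powr_mono2) auto
        then show ?thesis by (simp add: add_increasing2)
      next
        case False
        then have "v powr p \<le> v powr 2" using p by (intro powr_mono) auto
        then show ?thesis using False by simp
      qed
      also have "v\<^sup>2 = N * t\<^sup>2" using N1 by (simp add: v_def power_mult_distrib)
      finally have "N powr (- p / 2) * v powr p \<le> N powr (- p / 2) * (1 + N * t\<^sup>2)"
        by (intro mult_left_mono) auto
      moreover have "v powr p = N powr (p / 2) * \<bar>t\<bar> powr p"
        using N1 by (simp add: v_def powr_mult powr_half_sqrt[symmetric] powr_powr)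
      moreover have "N powr (- p / 2) * N powr (p / 2) = 1"
        using N1 by (simp flip: powr_add)
      ultimately show ?thesis by (simp flip: mult.assoc)
    qed
    have "(\<integral>\<^sup>+ X. ennreal (\<bar>T X x\<bar> powr p) \<partial>sample_measure n f)
        \<le> (\<integral>\<^sup>+ X. ennreal (N powr (- p / 2)) * (1 + ennreal N * ennreal ((T X x)\<^sup>2)) \<partial>sample_measure n f)"
    proof (rule nn_integral_mono)
      fix X
      show "ennreal (\<bar>T X x\<bar> powr p) \<le> ennreal (N powr (- p / 2)) * (1 + ennreal N * ennreal ((T X x)\<^sup>2))"
        using ennreal_leI[OF pt[of "T X x"]] N1 by (simp add: ennreal_mult ennreal_plus)
    qed
    also have "\<dots> = ennreal (N powr (- p / 2)) * (1 + ennreal N * (\<integral>\<^sup>+ X. ennreal ((T X x)\<^sup>2) \<partial>sample_measure n f))"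
      using Tm[of x] by (simp add: nn_integral_cmult nn_integral_add S.emeasure_space_1)
    also have "\<dots> \<le> ennreal (N powr (- p / 2)) * (1 + ennreal N * ennreal (A / N * (2 * g x)))"
      by (intro mult_left_mono add_left_mono dev2) auto
    also have "ennreal N * ennreal (A / N * (2 * g x)) = ennreal (2 * A) * ennreal (g x)"
      using N1 A g0[of x] by (simp flip: ennreal_mult)
    finally show ?thesis using True by simp
  next
    case False
    \<comment> \<open>Off the ball the second-moment bound is 0, so the deviation vanishes almost
      surely, and with it its p-th moment.\<close>
    have "(\<integral>\<^sup>+ X. ennreal ((T X x)\<^sup>2) \<partial>sample_measure n f) = 0"
      using dev2[of x] gB[OF False] by simp
    then have "AE X in sample_measure n f. ennreal ((T X x)\<^sup>2) = 0"
      using Tm[of x] by (subst (asm) nn_integral_0_iff_AE) auto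
    then have "(\<integral>\<^sup>+ X. ennreal (\<bar>T X x\<bar> powr p) \<partial>sample_measure n f) = (\<integral>\<^sup>+ X. 0 \<partial>sample_measure n f)"
      by (intro nn_integral_cong_AE) (auto elim!: eventually_mono)
    then show ?thesis by simp
  qed
  then have "(\<integral>\<^sup>+ x. \<integral>\<^sup>+ X. ennreal (\<bar>T X x\<bar> powr p) \<partial>sample_measure n f \<partial>lborel)
      \<le> (\<integral>\<^sup>+ x. ennreal (N powr (- p / 2)) * (indicator B x + ennreal (2 * A) * ennreal (g x)) \<partial>lborel)"
    by (intro nn_integral_mono)
  also have "\<dots> = ennreal (N powr (- p / 2)) * (emeasure lborel B + ennreal (2 * A) * (\<integral>\<^sup>+ x. ennreal (g x) \<partial>lborel))"
    by (simp add: nn_integral_cmult nn_integral_add)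
  also have "\<dots> \<le> ennreal (N powr (- p / 2)) * (ennreal (unit_ball_vol (real CARD('d)) * (R + \<rho>) ^ CARD('d)) + ennreal (2 * A) * ennreal \<kappa>)"
  proof (intro mult_left_mono add_mono)
    show "emeasure lborel B \<le> ennreal (unit_ball_vol (real CARD('d)) * (R + \<rho>) ^ CARD('d))"
      using R \<rho> by (simp add: B_def emeasure_cball)
    have "(\<integral>\<^sup>+ x. ennreal (\<bar>g x\<bar> powr 1) \<partial>lborel) \<le> ennreal ((\<integral>u. \<bar>(K u)\<^sup>2\<bar> \<partial>lborel) powr 1) * Lp_norm_pow 1 f"
      unfolding g_def by (intro nn_integral_shift_average_powr_le[OF sigma_finite_lborel K2]) auto
    then show "(\<integral>\<^sup>+ x. ennreal (g x) \<partial>lborel) \<le> ennreal \<kappa>"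
      using g0 \<kappa> by (simp add: prob_density_Lp_norm_pow_1[OF f] \<kappa>_def)
  qed auto
  also have "\<dots> = ennreal ((unit_ball_vol (real CARD('d)) * (R + \<rho>) ^ CARD('d) + A * (2 * \<kappa>)) * N powr (- p / 2))"
    using A \<kappa> R \<rho> by (simp flip: ennreal_mult ennreal_plus add: mult_ac)
  finally show ?thesis unfolding T_def N_def A_def .
qed

text \<open>The stochastic bound \<open>V\<close> is a hypothesis, so that both ranges of p share
  this step. Exchanging expectation and integration over space makes the pointwise moment bounds
  applicable; 2^p is the price of separating deviation and bias.\<close>

lemma kde_risk_le:
  fixes f K :: "real^'d::finite \<Rightarrow> real"
  assumes f: "prob_density f" and fs: "f \<in> sobolev_ball s p r" and K: "K \<in> kernels s"
    and s: "1 \<le> s" and h: "0 < h" and p: "1 \<le> p"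
    and V: "(\<integral>\<^sup>+ x. \<integral>\<^sup>+ X. ennreal (\<bar>kde K h n X x - (\<integral>u. K u * f (x + h *\<^sub>R u) \<partial>lborel)\<bar> powr p) \<partial>sample_measure n f \<partial>lborel)
      \<le> ennreal v"
    and v: "0 \<le> v"
  shows "sample_expectation n f (\<lambda>X. Lp_norm_pow p (\<lambda>x. kde K h n X x - f x))
    \<le> ennreal (2 powr p * (v + bias_const s p r K * h powr (real s * p)))"
proof -
  have Km[measurable]: "K \<in> borel_measurable borel" using K by (simp add: kernels_def)
  have fi: "integrable lborel f" using f by (auto simp: prob_density_def has_bochner_integral_iff)
  then have fm[measurable]: "f \<in> borel_measurable borel" by auto
  interpret S: prob_space "sample_measure n f" by (rule sample_measure_prob_space[OF f])
  interpret P: pair_sigma_finite "sample_measure n f" lborel by standard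
  define b where "b x = (\<integral>u. K u * f (x + h *\<^sub>R u) \<partial>lborel)" for x
  have bm[measurable]: "b \<in> borel_measurable borel" unfolding b_def by measurable
  have km[measurable]: "case_prod (kde K h n) \<in> borel_measurable (sample_measure n f \<Otimes>\<^sub>M lborel)"
    by (rule measurable_kde[OF Km])
  have bias: "(\<integral>\<^sup>+ x. ennreal (\<bar>b x - f x\<bar> powr p) \<partial>lborel) \<le> ennreal (bias_const s p r K * h powr (real s * p))"
    using kernel_bias_Lp_norm_pow_le[OF K s h p fi fs] unfolding Lp_norm_pow_def b_def .
  have bc: "0 \<le> bias_const s p r K"
    unfolding bias_const_def by (intro mult_nonneg_nonneg sum_nonneg) auto
  have "sample_expectation n f (\<lambda>X. Lp_norm_pow p (\<lambda>x. kde K h n X x - f x))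
      = (\<integral>\<^sup>+ x. \<integral>\<^sup>+ X. ennreal (\<bar>kde K h n X x - f x\<bar> powr p) \<partial>sample_measure n f \<partial>lborel)"
    unfolding sample_expectation_def Lp_norm_pow_def
    by (rule P.Fubini'[symmetric]) measurable
  also have "\<dots> \<le> (\<integral>\<^sup>+ x. \<integral>\<^sup>+ X. ennreal (2 powr p) * (ennreal (\<bar>kde K h n X x - b x\<bar> powr p) + ennreal (\<bar>b x - f x\<bar> powr p)) \<partial>sample_measure n f \<partial>lborel)"
  proof (intro nn_integral_mono)
    fix x X
    have "ennreal (\<bar>kde K h n X x - f x\<bar> powr p)
        \<le> ennreal (2 powr p * (\<bar>kde K h n X x - b x\<bar> powr p + \<bar>b x - f x\<bar> powr p))"
      using abs_add_powr_le[of p "kde K h n X x - b x" "b x - f x"] p by (intro ennreal_leI) auto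
    then show "ennreal (\<bar>kde K h n X x - f x\<bar> powr p)
        \<le> ennreal (2 powr p) * (ennreal (\<bar>kde K h n X x - b x\<bar> powr p) + ennreal (\<bar>b x - f x\<bar> powr p))"
      by (simp add: ennreal_mult ennreal_plus)
  qed
  also have "\<dots> = ennreal (2 powr p) * ((\<integral>\<^sup>+ x. \<integral>\<^sup>+ X. ennreal (\<bar>kde K h n X x - b x\<bar> powr p) \<partial>sample_measure n f \<partial>lborel)
      + (\<integral>\<^sup>+ x. ennreal (\<bar>b x - f x\<bar> powr p) \<partial>lborel))"
  proof -
    have m1: "(\<lambda>X. ennreal (\<bar>kde K h n X x - b x\<bar> powr p)) \<in> borel_measurable (sample_measure n f)" for x
    proof -
      have "(\<lambda>X. (X, x)) \<in> measurable (sample_measure n f) (sample_measure n f \<Otimes>\<^sub>M lborel)" by measurable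
      from measurable_compose[OF this km]
      have [measurable]: "(\<lambda>X. kde K h n X x) \<in> borel_measurable (sample_measure n f)" by simp
      show ?thesis by measurable
    qed
    have "(\<lambda>z. kde K h n (snd z) (fst z)) \<in> borel_measurable (lborel \<Otimes>\<^sub>M sample_measure n f)"
      using measurable_pair_swap[OF km] by (simp add: split_beta')
    then have m2: "(\<lambda>x. \<integral>\<^sup>+ X. ennreal (\<bar>kde K h n X x - b x\<bar> powr p) \<partial>sample_measure n f) \<in> borel_measurable lborel"
      by (intro S.borel_measurable_nn_integral) (simp add: split_beta')
    show ?thesis
      using m1 m2 by (simp add: nn_integral_cmult nn_integral_add S.emeasure_space_1)
  qed
  also have "\<dots> \<le> ennreal (2 powr p) * (ennreal v + ennreal (bias_const s p r K * h powr (real s * p)))"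
    using V bias unfolding b_def[symmetric] by (intro mult_left_mono add_mono) auto
  also have "\<dots> = ennreal (2 powr p * (v + bias_const s p r K * h powr (real s * p)))"
    using v bc by (simp flip: ennreal_mult ennreal_plus)
  finally show ?thesis .
qed

theorem theorem6p1:
  fixes s :: nat and p r R :: real and K :: "real^'d::finite \<Rightarrow> real"
    and F :: "(real^'d \<Rightarrow> real) set" and h :: "nat \<Rightarrow> real"
  assumes "1 \<le> s" and "1 \<le> p" and "0 < r" and "p = 1 \<Longrightarrow> 1 < r" and "0 < R"
    and "p \<ge> 2 \<Longrightarrow> K \<in> kernels s"
    and "p < 2 \<Longrightarrow> K \<in> kernels_compact s"
    and "F = (if p \<ge> 2 then sobolev_densities s p r else sobolev_densities_supp s p r R)"
    and "\<And>n. h n = real n powr (- (1 / (2 * real s + real CARD('d))))"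
  shows "\<exists>c>0. \<forall>n\<ge>1.
    (SUP f\<in>F. sample_expectation n f (\<lambda>X. Lp_norm_pow p (\<lambda>x. kde K (h n) n X x - f x)))
      \<le> ennreal (c * real n powr (- (real s * p / (2 * real s + real CARD('d)))))"
proof -
  note s = \<open>1 \<le> s\<close> and p = \<open>1 \<le> p\<close> and hdef = assms(9)
  have K: "K \<in> kernels s" using assms(6,7) by (cases "p \<ge> 2") (auto simp: kernels_compact_def)
  define D where "D = 2 * real s + real CARD('d)"
  have D: "0 < D" using s by (simp add: D_def add_pos_nonneg)
  define \<epsilon> where "\<epsilon> n = real n powr (- (real s * p / D))" for n
  have h: "0 < h n" "h n \<le> 1" if "1 \<le> n" for n
  proof -
    show "0 < h n" using that by (simp add: hdef)
    have "h n \<le> real n powr 0"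
      unfolding hdef using that by (intro powr_mono) auto
    then show "h n \<le> 1" using that by simp
  qed
  \<comment> \<open>With D = 2 s + d the exponent of n h^d is 1 - d/D = 2 s/D. It is nonnegative,
    hence n h^d >= 1.\<close>
  have N: "real n * h n ^ CARD('d) = real n powr (2 * real s / D)" if "1 \<le> n" for n
  proof -
    have "h n ^ CARD('d) = real n powr (- (real CARD('d) / D))"
      using h(1)[OF that] unfolding hdef by (simp flip: powr_realpow add: powr_powr D_def)
    then have "real n * h n ^ CARD('d) = real n powr (1 + - (real CARD('d) / D))"
      using that by (simp only: powr_add) simp
    also have "1 + - (real CARD('d) / D) = 2 * real s / D"
      using D by (simp add: D_def field_simps)
    finally show ?thesis .
  qed
  have N1: "1 \<le> real n * h n ^ CARD('d)" if "1 \<le> n" for n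
    unfolding N[OF that] using that D by (intro ge_one_powr_ge_zero) auto
  \<comment> \<open>This and \<open>h\<epsilon>\<close> are the balance behind the bandwidth: (n
    h^d)^(-p/2) and h^(s p) are the same power of n.\<close>
  have N\<epsilon>: "(real n * h n ^ CARD('d)) powr (- p / 2) = \<epsilon> n" if "1 \<le> n" for n
    unfolding N[OF that] \<epsilon>_def by (simp add: powr_powr)
  have h\<epsilon>: "h n powr (real s * p) = \<epsilon> n" for n
    unfolding hdef \<epsilon>_def by (simp add: powr_powr D_def)
  obtain m where m: "0 < m" "\<And>u. \<bar>K u\<bar> \<le> m"
  proof -
    have "bounded (range K)" using K by (simp add: kernels_def)
    then show thesis using that by (auto simp: bounded_pos)
  qed
  define \<kappa> where "\<kappa> = (\<integral>u. (K u)\<^sup>2 \<partial>lborel)"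
  have \<kappa>: "0 \<le> \<kappa>" by (simp add: \<kappa>_def)
  have F: "prob_density f" "f \<in> sobolev_ball s p r" if "f \<in> F" for f
    using that by (auto simp: assms(8) sobolev_densities_def sobolev_densities_supp_def split: if_splits)
  \<comment> \<open>\<open>V\<close> is chosen before \<open>f\<close> and \<open>n\<close>, so the
    later bound is uniform over the class and passes to the supremum.\<close>
  obtain V where V: "0 \<le> V" and dev: "\<And>f n. f \<in> F \<Longrightarrow> 1 \<le> n \<Longrightarrow>
      (\<integral>\<^sup>+ x. \<integral>\<^sup>+ X. ennreal (\<bar>kde K (h n) n X x - (\<integral>u. K u * f (x + h n *\<^sub>R u) \<partial>lborel)\<bar> powr p)
        \<partial>sample_measure n f \<partial>lborel) \<le> ennreal (V * \<epsilon> n)"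
  proof (cases "p \<ge> 2")
    case True
    show thesis
    proof (rule that)
      show "0 \<le> stoch_const p m * (2 * \<kappa> + \<kappa> powr p * r powr p)"
        using \<kappa> stoch_const_nonneg[OF True] by (intro mult_nonneg_nonneg add_nonneg_nonneg) auto
      fix f n assume "f \<in> F" and n: "1 \<le> (n::nat)"
      then show "(\<integral>\<^sup>+ x. \<integral>\<^sup>+ X. ennreal (\<bar>kde K (h n) n X x - (\<integral>u. K u * f (x + h n *\<^sub>R u) \<partial>lborel)\<bar> powr p)
          \<partial>sample_measure n f \<partial>lborel) \<le> ennreal (stoch_const p m * (2 * \<kappa> + \<kappa> powr p * r powr p) * \<epsilon> n)"
        using kde_deviation_Lp_le[OF F K m(2) m(1) h(1)[OF n] n N1[OF n] True]
        unfolding N\<epsilon>[OF n] \<kappa>_def by blast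
    qed
  next
    case False
    then have p2: "p < 2" by simp
    then have "compact (closure {x. K x \<noteq> 0})"
      using assms(7) by (simp add: kernels_compact_def)
    then have "bounded {x. K x \<noteq> 0}"
      by (rule bounded_subset[OF compact_imp_bounded closure_subset])
    then obtain \<rho> where \<rho>: "0 < \<rho>" "\<And>u. K u \<noteq> 0 \<Longrightarrow> norm u \<le> \<rho>"
      by (auto simp: bounded_pos)
    let ?V = "unit_ball_vol (real CARD('d)) * (R + \<rho>) ^ CARD('d) + stoch_const 2 m * (2 * \<kappa>)"
    show thesis
    proof (rule that)
      show "0 \<le> ?V"
        using \<kappa> stoch_const_nonneg[of 2 m] \<open>0 < R\<close> \<rho> by (intro mult_nonneg_nonneg add_nonneg_nonneg) auto
      fix f n assume f: "f \<in> F" and n: "1 \<le> (n::nat)"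
      from f p2 obtain x0 where supp: "AE x in lborel. x \<notin> cball x0 R \<longrightarrow> f x = 0"
        by (auto simp: assms(8) sobolev_densities_supp_def)
      show "(\<integral>\<^sup>+ x. \<integral>\<^sup>+ X. ennreal (\<bar>kde K (h n) n X x - (\<integral>u. K u * f (x + h n *\<^sub>R u) \<partial>lborel)\<bar> powr p)
          \<partial>sample_measure n f \<partial>lborel) \<le> ennreal (?V * \<epsilon> n)"
        using kde_deviation_Lp_le_compact[OF F(1)[OF f] K supp \<rho>(2) _ _ m(2) m(1) h[OF n] n N1[OF n] p p2]
          \<open>0 < R\<close> \<rho>(1)
        unfolding N\<epsilon>[OF n] \<kappa>_def by auto
    qed
  qed
  \<comment> \<open>The summand 1 keeps \<open>c\<close> positive even if the other constants
    vanish.\<close>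
  define c where "c = 2 powr p * (V + bias_const s p r K) + 1"
  have "0 \<le> bias_const s p r K"
    unfolding bias_const_def by (intro mult_nonneg_nonneg sum_nonneg) auto
  then have "0 < c"
    using V by (auto simp: c_def intro!: add_nonneg_pos)
  moreover have "(SUP f\<in>F. sample_expectation n f (\<lambda>X. Lp_norm_pow p (\<lambda>x. kde K (h n) n X x - f x)))
      \<le> ennreal (c * \<epsilon> n)" if n: "1 \<le> n" for n
  proof (rule SUP_least)
    fix f assume f: "f \<in> F"
    have \<epsilon>: "0 \<le> \<epsilon> n" by (simp add: \<epsilon>_def)
    have "sample_expectation n f (\<lambda>X. Lp_norm_pow p (\<lambda>x. kde K (h n) n X x - f x))
        \<le> ennreal (2 powr p * (V * \<epsilon> n + bias_const s p r K * h n powr (real s * p)))"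
      using V \<epsilon> by (intro kde_risk_le[OF F[OF f] K s h(1)[OF n] p dev[OF f n]]) auto
    also have "\<dots> \<le> ennreal (c * \<epsilon> n)"
      using \<epsilon> unfolding h\<epsilon> c_def by (intro ennreal_leI) (simp add: algebra_simps)
    finally show "sample_expectation n f (\<lambda>X. Lp_norm_pow p (\<lambda>x. kde K (h n) n X x - f x))
        \<le> ennreal (c * \<epsilon> n)" .
  qed
  ultimately show ?thesis
    unfolding \<epsilon>_def D_def by blast
qed

end
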